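(* For every $\beta\in(0,1)$, the random variable $\mathbf{W}_\beta=-\log(\mathbf{K}_\beta)$ is self-decomposable, without drift (that is, with drift coefficient $0$), and with a spectral function taking the value $1/2$ at $0+$.
   Context: Kanter random variable: for $c\in(0,1)$ and $u\in(0,1)$ set $$b_c(u)=\frac{\sin(\pi u)}{\sin^c(\pi c u)\,\sin^{1-c}(\pi(1-c)u)},\qquad \kappa_c=c^{-c}(1-c)^{c-1},$$ and let $\mathbf{K}_c=\kappa_c^{-1}b_c(\mathbf{U})$ where $\mathbf{U}$ is uniform on $(0,1)$. The function $b_c$ decreases from $\kappa_c$ to $0$ on $(0,1)$, so $\mathbf{K}_c$ has support $[0,1]$ and $\mathbf{W}_c=-\log(\mathbf{K}_c)$ has support $\mathbb{R}^+$. Self-decomposability: a positive random variable $X$ is self-decomposable if its Laplace transform reads $$\mathbb{E}[e^{-\lambda X}]=\exp-\left[a_X\lambda+\int_0^\infty(1-e^{-\lambda x})\frac{\varphi_X(x)}{x}\,dx\right],\qquad\lambda\ge0,$$ for some $a_X\ge0$, called the drift coefficient of $X$, and some non-increasing function $\varphi_X:(0,+\infty)\to\mathbb{R}^+$, called the spectral function of $X$. The value of $\varphi_X$ at $0+$ is $\lim_{x\to0+}\varphi_X(x)$. *)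

theory Defs
  imports "HOL-Probability.Probability"
begin

definition kanter_b :: "real \<Rightarrow> real \<Rightarrow> real" where
  "kanter_b c u =
     sin (pi * u) / (sin (pi * c * u) powr c * sin (pi * (1 - c) * u) powr (1 - c))"

definition kanter_kappa :: "real \<Rightarrow> real" where
  "kanter_kappa c = c powr (- c) * (1 - c) powr (c - 1)"

text \<open>The Kanter random variable built from a random variable \<open>U\<close>, meant to be uniform
  on the open unit interval.\<close>

definition kanter_K :: "real \<Rightarrow> ('a \<Rightarrow> real) \<Rightarrow> 'a \<Rightarrow> real" where
  "kanter_K c U = (\<lambda>\<omega>. inverse (kanter_kappa c) * kanter_b c (U \<omega>))"

definition kanter_W :: "real \<Rightarrow> ('a \<Rightarrow> real) \<Rightarrow> 'a \<Rightarrow> real" where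
  "kanter_W c U = (\<lambda>\<omega>. - ln (kanter_K c U \<omega>))"

text \<open>\<open>self_decomposable_with M X a \<phi>\<close>: the positive random variable \<open>X\<close> on the
  probability space \<open>M\<close> is self-decomposable with drift coefficient \<open>a\<close> and spectral
  function \<open>\<phi>\<close>. Only the values of \<open>\<phi>\<close> on the positive half-line matter. Integrability has to be
  required separately, since the Bochner integral of a non-integrable function is \<open>0\<close>, whereas a
  divergent integral would make the right-hand side of the Laplace transform vanish.\<close>

definition self_decomposable_with ::
    "'a measure \<Rightarrow> ('a \<Rightarrow> real) \<Rightarrow> real \<Rightarrow> (real \<Rightarrow> real) \<Rightarrow> bool" where
  "self_decomposable_with M X a \<phi> \<longleftrightarrow>
     prob_space M \<and> X \<in> borel_measurable M \<and> (AE \<omega> in M. 0 < X \<omega>) \<and>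
     0 \<le> a \<and> (\<forall>x>0. 0 \<le> \<phi> x) \<and> antimono_on {0<..} \<phi> \<and>
     (\<forall>s\<ge>0.
        set_integrable lborel {0<..} (\<lambda>x. (1 - exp (- s * x)) * (\<phi> x / x)) \<and>
        (LINT \<omega>|M. exp (- s * X \<omega>)) =
          exp (- (a * s + (LINT x:{0<..}|lborel. (1 - exp (- s * x)) * (\<phi> x / x)))))"

definition self_decomposable :: "'a measure \<Rightarrow> ('a \<Rightarrow> real) \<Rightarrow> bool" where
  "self_decomposable M X \<longleftrightarrow> (\<exists>a \<phi>. self_decomposable_with M X a \<phi>)"

end

theory Submission
  imports Defs "HOL-Complex_Analysis.Complex_Analysis" "HOL-Real_Asymp.Real_Asymp"
begin

text \<open>
  Everything rests on the fractional moments of \<open>b\<^sub>c\<close>: for \<open>s > 0\<close>,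
  \[ \int_0^1 b_c(u)^s \, du = \frac{\Gamma(1+s)}{\Gamma(1+cs)\,\Gamma(1+(1-c)s)}, \]
  which is \<open>kanter_moment\<close>. The right-hand side is the generalised binomial coefficient
  ``\<open>s\<close> choose \<open>cs\<close>'', and hence the integral of \<open>(1+z)^s z^(-cs) dz/z\<close>, divided by \<open>2\<pi>i\<close>, over a
  loop about the origin from \<open>-1\<close> to \<open>-1\<close>. Along the unit circle this is Cauchy's integral of
  \<open>cos^s x cos(tx)\<close>, evaluated in \<open>cos_integral_eq\<close>; along the curve on which
  \<open>arg(1+z) = c arg z\<close> the function \<open>(1+z)^s z^(-cs)\<close> is real, and by the law of sines it is
  \<open>b\<^sub>c\<close> raised to the power \<open>s\<close>. Cauchy's theorem identifies the two.

  Since \<open>W\<^sub>c = - log K\<^sub>c\<close>, the moments give the Laplace transform of \<open>W\<^sub>c\<close>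
  (\<open>kanter_W_laplace\<close>). Malmsten's integral for \<open>log \<Gamma>(1+s)\<close> turns its
  logarithm into an integral over the half-line; rescaling the three integrals to a common
  factor \<open>1 - e^(-sx)\<close> leaves the weight \<open>\<phi>(x)/x\<close> with
  \[ \varphi(x) = \frac{1}{e^x-1} - \frac{1}{e^{x/c}-1} - \frac{1}{e^{x/(1-c)}-1}, \]
  and the rescaling produces exactly the linear term \<open>s log \<kappa>\<^sub>c\<close> that cancels the
  normalisation of \<open>K\<^sub>c\<close>, whence no drift (\<open>kanter_spectral_integral\<close>).

  The identity \<open>- d/dx 1/(e^x-1) = 1/(4 sinh^2(x/2))\<close> and the inequality
  \<open>sinh(y/c) \<ge> sinh(y)/c\<close> show that \<open>\<phi>\<close> is non-increasing; it tends to \<open>0\<close> at infinity, so it is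
  also nonnegative. The expansion \<open>1/(e^x-1) = 1/x - 1/2 + o(1)\<close> gives \<open>\<phi>(0+) = 1/2\<close>, because the
  poles cancel thanks to \<open>c + (1-c) = 1\<close>.
\<close>

section \<open>Frullani and Malmsten integrals\<close>

abbreviation halfline :: "real measure" where
  "halfline \<equiv> restrict_space lborel {0<..}"

lemma exp_chord_integral:
  fixes p q y :: real
  assumes "p \<le> q" "0 < y"
  shows "(\<integral>\<^sup>+t. ennreal (exp (- t * y)) * indicator {p..q} t \<partial>lborel)
           = ennreal ((exp (- p * y) - exp (- q * y)) / y)"
proof -
  have "(\<integral>\<^sup>+t. ennreal (exp (- t * y)) * indicator {p..q} t \<partial>lborel)
          = ennreal (- exp (- q * y) / y - - exp (- p * y) / y)"
    using assms
    by (intro nn_integral_FTC_Icc) (auto intro!: derivative_eq_intros simp: field_simps)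
  then show ?thesis
    by (simp add: diff_divide_distrib)
qed

lemma laplace_of_one:
  fixes t :: real
  assumes "0 < t"
  shows "(\<integral>\<^sup>+y. ennreal (exp (- t * y)) * indicator {0..} y \<partial>lborel) = ennreal (1 / t)"
proof -
  have "((\<lambda>y. - exp (- t * y) / t) \<longlongrightarrow> 0) at_top"
    using assms by real_asymp
  then have "(\<integral>\<^sup>+y. ennreal (exp (- t * y)) * indicator {0..} y \<partial>lborel)
          = ennreal (0 - - exp (- t * 0) / t)"
    using assms
    by (intro nn_integral_FTC_atLeast) (auto intro!: derivative_eq_intros simp: field_simps)
  then show ?thesis
    by simp
qed

text \<open>
  Writing the integrand as \<open>\<integral> exp(-ty) dt\<close> over \<open>[p, q]\<close> and swapping the integrals leaves
  \<open>\<integral> 1/t dt\<close>. The ordering of \<open>p\<close> and \<open>q\<close> makes the integrand nonnegative, as Tonelli's theorem wants.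
\<close>

lemma Frullani_exp_aux:
  fixes p q :: real
  assumes "0 < p" "p \<le> q"
  shows "has_bochner_integral halfline (\<lambda>y. (exp (- p * y) - exp (- q * y)) / y) (ln (q / p))"
proof -
  let ?g = "\<lambda>y. (exp (- p * y) - exp (- q * y)) / y"
  have "(\<integral>\<^sup>+y. ennreal (indicator {0<..} y * ?g y) \<partial>lborel)
      = (\<integral>\<^sup>+y. \<integral>\<^sup>+t. ennreal (exp (- t * y)) * indicator {p..q} t * indicator {0<..} y \<partial>lborel \<partial>lborel)"
  proof (intro nn_integral_cong)
    fix y :: real
    show "ennreal (indicator {0<..} y * ?g y)
        = (\<integral>\<^sup>+t. ennreal (exp (- t * y)) * indicator {p..q} t * indicator {0<..} y \<partial>lborel)"
      using exp_chord_integral[OF assms(2), of y] by (cases "0 < y") auto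
  qed
  also have "\<dots> = (\<integral>\<^sup>+t. \<integral>\<^sup>+y. ennreal (exp (- t * y)) * indicator {p..q} t * indicator {0<..} y \<partial>lborel \<partial>lborel)"
    by (rule lborel_pair.Fubini') measurable
  also have "\<dots> = (\<integral>\<^sup>+t. ennreal (1 / t) * indicator {p..q} t \<partial>lborel)"
  proof (intro nn_integral_cong)
    fix t :: real
    have "(\<integral>\<^sup>+y. ennreal (exp (- t * y)) * indicator {0<..} y \<partial>lborel)
        = (\<integral>\<^sup>+y. ennreal (exp (- t * y)) * indicator {0..} y \<partial>lborel)"
      by (intro nn_integral_cong_AE AE_I[where N="{0}"]) (auto simp: indicator_def)
    then show "(\<integral>\<^sup>+y. ennreal (exp (- t * y)) * indicator {p..q} t * indicator {0<..} y \<partial>lborel)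
        = ennreal (1 / t) * indicator {p..q} t"
      using laplace_of_one[of t] assms by (cases "t \<in> {p..q}") auto
  qed
  also have "\<dots> = ennreal (ln q - ln p)"
    using assms by (intro nn_integral_FTC_Icc) (auto intro!: derivative_eq_intros)
  finally have *: "(\<integral>\<^sup>+y. ennreal (indicator {0<..} y * ?g y) \<partial>lborel) = ennreal (ln (q / p))"
    using assms by (simp add: ln_div)
  have "has_bochner_integral lborel (\<lambda>y. indicator {0<..} y * ?g y) (ln (q / p))"
    using assms by (intro has_bochner_integral_nn_integral *)
      (auto simp: indicator_def intro!: divide_nonneg_pos)
  then show ?thesis
    by (simp add: has_bochner_integral_restrict_space)
qed

lemma Frullani_exp:
  fixes p q :: real
  assumes "0 < p" "0 < q"
  shows "has_bochner_integral halfline (\<lambda>y. (exp (- p * y) - exp (- q * y)) / y) (ln (q / p))"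
proof (cases "p \<le> q")
  case True
  then show ?thesis using Frullani_exp_aux assms by blast
next
  case False
  then have "has_bochner_integral halfline (\<lambda>y. - ((exp (- q * y) - exp (- p * y)) / y)) (- ln (p / q))"
    using assms by (intro has_bochner_integral_minus Frullani_exp_aux) auto
  then show ?thesis
    using assms by (simp add: ln_div diff_divide_distrib)
qed

lemma halfline_scale:
  fixes c :: real and f :: "real \<Rightarrow> real"
  assumes "0 < c" "has_bochner_integral halfline f v"
  shows "has_bochner_integral halfline (\<lambda>x. f (x / c) / c) v"
proof -
  have "has_bochner_integral lborel (\<lambda>x. indicator {0<..} x *\<^sub>R f x) v"
    using assms(2) by (simp add: has_bochner_integral_restrict_space)
  then have "has_bochner_integral lborel (\<lambda>x. indicator {0<..} (0 + (1/c) * x) *\<^sub>R f (0 + (1/c) * x)) (v /\<^sub>R \<bar>1/c\<bar>)"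
    using assms(1) by (subst (asm) lborel_has_bochner_integral_real_affine_iff[where c = "1/c" and t = 0]) auto
  then have "has_bochner_integral lborel (\<lambda>x. (1/c) * (indicator {0<..} (0 + (1/c) * x) *\<^sub>R f (0 + (1/c) * x))) ((1/c) * (v /\<^sub>R \<bar>1/c\<bar>))"
    by (rule has_bochner_integral_mult_right)
  also have "(1/c) * (v /\<^sub>R \<bar>1/c\<bar>) = v"
    using assms(1) by simp
  also have "(\<lambda>x. (1/c) * (indicator {0<..} (0 + (1/c) * x) *\<^sub>R f (0 + (1/c) * x))) = (\<lambda>x. indicator {0<..} x *\<^sub>R (f (x / c) / c))"
    using assms(1) by (auto simp: fun_eq_iff indicator_def zero_less_divide_iff)
  finally show ?thesis
    by (simp add: has_bochner_integral_restrict_space)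
qed

text \<open>
  Bernoulli's inequality for real exponents in the variable \<open>exp(-y)\<close>, read off from the chord of
  the convex function \<open>exp\<close> on \<open>[-y, 0]\<close>. The reverse inequality for \<open>s \<ge> 1\<close> is the same
  statement for the exponent \<open>1/s\<close>.
\<close>

lemma exp_Bernoulli:
  fixes s y :: real
  assumes "0 \<le> s" "s \<le> 1"
  shows "s * (1 - exp (- y)) \<le> 1 - exp (- s * y)"
  using convex_onD[OF exp_convex, of s 0 "- y"] assms by (simp add: algebra_simps)

lemma exp_Bernoulli':
  fixes s y :: real
  assumes "1 \<le> s"
  shows "1 - exp (- s * y) \<le> s * (1 - exp (- y))"
  using exp_Bernoulli[of "1/s" "s * y"] assms by (simp add: field_simps)

text \<open>
  The logarithm of Euler's product for the Gamma function.
\<close>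

lemma ln_Gamma_Euler_sum:
  fixes s :: real
  assumes "0 \<le> s"
  shows "(\<lambda>n. \<Sum>k=1..n. ln (1 + s / real k) - s * ln (1 + 1 / real k)) \<longlonglongrightarrow> - ln (Gamma (1 + s))"
proof (cases "s = 0")
  case True then show ?thesis by simp
next
  case False
  with assms have s: "s > 0" by simp
  have pos: "0 < 1 + s / real k" for k
    using s by (intro add_pos_nonneg) auto
  from s have "s \<notin> \<int>\<^sub>\<le>\<^sub>0" by (auto elim!: nonpos_Ints_cases)
  then have "(\<lambda>n. - ln (s * Gamma_series_euler' s n)) \<longlonglongrightarrow> - ln (s * Gamma s)"
    using s by (intro tendsto_intros Gamma_series_euler') (auto simp: Gamma_real_pos less_imp_neq[symmetric])
  moreover have "s * Gamma s = Gamma (1 + s)"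
    using Gamma_plus1[OF \<open>s \<notin> _\<close>] by (simp add: add.commute)
  moreover have "- ln (s * Gamma_series_euler' s n) = (\<Sum>k=1..n. ln (1 + s / real k) - s * ln (1 + 1 / real k))" for n
  proof -
    have "s * Gamma_series_euler' s n = (\<Prod>k=1..n. exp (s * ln (1 + 1 / real k)) / (1 + s / real k))"
      using s by (simp add: Gamma_series_euler'_def field_simps)
    also have "ln \<dots> = (\<Sum>k=1..n. ln (exp (s * ln (1 + 1 / real k)) / (1 + s / real k)))"
      using pos by (intro ln_prod) (auto simp: less_imp_neq[symmetric])
    also have "\<dots> = (\<Sum>k=1..n. s * ln (1 + 1 / real k) - ln (1 + s / real k))"
      using pos by (intro sum.cong refl, subst ln_div) (auto simp: less_imp_neq[symmetric])
    finally show ?thesis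
      by (simp add: sum_subtractf)
  qed
  ultimately show ?thesis by simp
qed

text \<open>
  Each term of Euler's series for \<open>- log \<Gamma>(1+s)\<close> is a difference of two Frullani integrals, with
  integrand \<open>exp(-ky)\<close> times \<open>h(y)/y\<close>, where \<open>h(y) = (1 - exp(-sy)) - s (1 - exp(-y))\<close>. By
  Bernoulli's inequality \<open>h\<close> does not change sign, so the geometric series in \<open>k\<close> may be
  summed under the integral by monotone convergence.
\<close>

lemma Malmsten:
  fixes s :: real
  assumes s: "0 \<le> s"
  shows "has_bochner_integral halfline (\<lambda>y. ((1 - exp (- s * y)) / (exp y - 1) - s * exp (- y)) / y)
           (- ln (Gamma (1 + s)))"
proof -
  \<comment> \<open>The sign of \<open>h\<close>, which lets the cases \<open>s \<le> 1\<close> and \<open>s \<ge> 1\<close> be treated at once.\<close>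
  define \<sigma> :: real where "\<sigma> = (if s \<le> 1 then 1 else - 1)"
  have \<sigma>: "\<sigma> * \<sigma> = 1" by (simp add: \<sigma>_def)
  define h where "h y = (1 - exp (- s * y)) - s * (1 - exp (- y))" for y :: real
  define g where "g k y = exp (- real k * y) * h y / y" for k y
  have h_sign: "0 \<le> \<sigma> * h y" for y
    using exp_Bernoulli[of s y] exp_Bernoulli'[of s y] s by (auto simp: \<sigma>_def h_def)
  have g_int: "has_bochner_integral halfline (g k) (ln (1 + s / real k) - s * ln (1 + 1 / real k))"
    if "k \<ge> 1" for k
  proof -
    have "has_bochner_integral halfline
       (\<lambda>y. (exp (- real k * y) - exp (- (real k + s) * y)) / y
          - s * ((exp (- real k * y) - exp (- (real k + 1) * y)) / y))
       (ln ((real k + s) / real k) - s * ln ((real k + 1) / real k))"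
      using that s by (intro has_bochner_integral_diff has_bochner_integral_mult_right Frullani_exp) auto
    moreover have "(real k + s) / real k = 1 + s / real k" "(real k + 1) / real k = 1 + 1 / real k"
      using that by (simp_all add: add_divide_distrib)
    moreover have "(\<lambda>y. (exp (- real k * y) - exp (- (real k + s) * y)) / y
          - s * ((exp (- real k * y) - exp (- (real k + 1) * y)) / y)) = g k"
      by (simp add: fun_eq_iff g_def h_def algebra_simps exp_add[symmetric] flip: diff_divide_distrib add_divide_distrib)
    ultimately show ?thesis by simp
  qed
  define G where "G n y = \<sigma> * (\<Sum>k=1..n. g k y)" for n y
  define u where "u y = \<sigma> * (((1 - exp (- s * y)) / (exp y - 1) - s * exp (- y)) / y)" for y
  have G_int: "has_bochner_integral halfline (G n)
      (\<sigma> * (\<Sum>k=1..n. ln (1 + s / real k) - s * ln (1 + 1 / real k)))" for n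
    unfolding G_def by (intro has_bochner_integral_mult_right has_bochner_integral_sum g_int) auto
  have sg: "0 \<le> \<sigma> * g k y" if "0 < y" for k y
    using mult_nonneg_nonneg[OF _ h_sign[of y], of "exp (- real k * y) / y"] that
    by (simp add: g_def mult_ac)
  have G_lim: "(\<lambda>n. G n y) \<longlonglongrightarrow> u y" if y: "0 < y" for y
  proof -
    have "(\<lambda>n. exp (- y) ^ n) sums (1 / (1 - exp (- y)))"
      using y by (intro geometric_sums) auto
    then have "(\<lambda>n. exp (- y) ^ Suc n) sums (1 / (1 - exp (- y)) * exp (- y))"
      by (subst power_Suc2) (rule sums_mult2)
    then have "(\<lambda>n. \<Sum>k<n. exp (- y) ^ Suc k) \<longlonglongrightarrow> 1 / (exp y - 1)"
      using y by (simp add: sums_def exp_minus field_simps)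
    then have lim: "(\<lambda>n. \<sigma> * ((\<Sum>k<n. exp (- y) ^ Suc k) * h y / y)) \<longlonglongrightarrow> \<sigma> * (1 / (exp y - 1) * h y / y)"
      using y by (intro tendsto_intros) auto
    have h_eq: "1 / (exp y - 1) * h y = (1 - exp (- s * y)) / (exp y - 1) - s * exp (- y)"
      using y by (simp add: h_def field_simps exp_minus)
    have G_eq: "\<sigma> * ((\<Sum>k<n. exp (- y) ^ Suc k) * h y / y) = G n y" for n
    proof -
      have "(\<Sum>k<n. exp (- y) ^ Suc k) = (\<Sum>k=1..n. exp (- y) ^ k)"
        by (rule sum.reindex_bij_witness[of _ "\<lambda>k. k - 1" Suc]) auto
      then show ?thesis
        by (simp add: G_def g_def sum_distrib_right sum_divide_distrib exp_of_nat_mult[symmetric])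
    qed
    show ?thesis using lim unfolding u_def h_eq G_eq .
  qed
  have mono: "AE y in halfline. mono (\<lambda>n. G n y)"
  proof (rule AE_I2)
    fix y assume "y \<in> space halfline"
    then have "0 < y" by (simp add: space_restrict_space)
    show "mono (\<lambda>n. G n y)"
    proof (rule incseq_SucI)
      show "G n y \<le> G (Suc n) y" for n
        using sg[OF \<open>0 < y\<close>, of "Suc n"] by (simp add: G_def distrib_left)
    qed
  qed
  have pos: "AE y in halfline. 0 \<le> G n y" for n
    unfolding G_def sum_distrib_left
    by (intro AE_I2 sum_nonneg sg) (simp add: space_restrict_space)
  have lim: "AE y in halfline. (\<lambda>n. G n y) \<longlonglongrightarrow> u y"
    using G_lim by (intro AE_I2) (simp add: space_restrict_space)
  have ilim: "(\<lambda>n. integral\<^sup>L halfline (G n)) \<longlonglongrightarrow> \<sigma> * (- ln (Gamma (1 + s)))"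
    unfolding has_bochner_integral_integral_eq[OF G_int]
    by (intro tendsto_mult tendsto_const ln_Gamma_Euler_sum s)
  have meas: "u \<in> borel_measurable halfline"
    unfolding u_def by (intro measurable_restrict_space1) measurable
  have int: "integrable halfline (G n)" for n
    using G_int has_bochner_integral_iff by blast
  have "has_bochner_integral halfline u (\<sigma> * (- ln (Gamma (1 + s))))"
    using integral_monotone_convergence_nonneg[OF int mono pos lim ilim meas]
    by (simp add: has_bochner_integral_iff)
  then have "has_bochner_integral halfline (\<lambda>y. \<sigma> * u y) (\<sigma> * (\<sigma> * (- ln (Gamma (1 + s)))))"
    by (rule has_bochner_integral_mult_right)
  moreover have "\<sigma> * (\<sigma> * z) = z" for z
    using \<sigma> by (simp flip: mult.assoc)
  ultimately show ?thesis
    unfolding u_def by simp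
qed

section \<open>The spectral function\<close>

text \<open>
  The substitution \<open>y = x/c\<close> keeps \<open>dy/y\<close> but moves the counterterm \<open>exp(-y)\<close> to \<open>exp(-x/c)\<close>.
  Restoring \<open>exp(-x)\<close> costs a Frullani integral, the source of the term \<open>s c log c\<close>.
\<close>

lemma Malmsten_rescaled:
  fixes s c :: real
  assumes "0 \<le> s" "0 < c"
  shows "has_bochner_integral halfline
           (\<lambda>x. ((1 - exp (- s * x)) / (exp (x / c) - 1) - s * c * exp (- x)) / x)
           (s * (c * ln c) - ln (Gamma (1 + c * s)))"
proof -
  let ?m = "\<lambda>x. ((1 - exp (- (c * s) * (x / c))) / (exp (x / c) - 1) - c * s * exp (- (x / c))) / (x / c) / c"
  have "has_bochner_integral halfline
      (\<lambda>x. ?m x + s * c * ((exp (- (1 / c) * x) - exp (- 1 * x)) / x))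
      (- ln (Gamma (1 + c * s)) + s * c * ln (1 / (1 / c)))"
    using assms
    by (intro has_bochner_integral_add has_bochner_integral_mult_right Frullani_exp
          halfline_scale[OF _ Malmsten]) auto
  moreover have "(\<lambda>x. ?m x + s * c * ((exp (- (1 / c) * x) - exp (- 1 * x)) / x))
      = (\<lambda>x. ((1 - exp (- s * x)) / (exp (x / c) - 1) - s * c * exp (- x)) / x)"
  proof
    fix x
    have "?m x = ((1 - exp (- s * x)) / (exp (x / c) - 1) - c * s * exp (- (x / c))) / x"
      using assms(2) by simp
    then show "?m x + s * c * ((exp (- (1 / c) * x) - exp (- 1 * x)) / x)
        = ((1 - exp (- s * x)) / (exp (x / c) - 1) - s * c * exp (- x)) / x"
      by (simp add: algebra_simps diff_divide_distrib add_divide_distrib)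
  qed
  ultimately show ?thesis
    by (simp add: algebra_simps)
qed

definition kanter_spectral :: "real \<Rightarrow> real \<Rightarrow> real" where
  "kanter_spectral c x = 1 / (exp x - 1) - 1 / (exp (x / c) - 1) - 1 / (exp (x / (1 - c)) - 1)"

text \<open>
  The counterterms \<open>s k exp(-x)\<close> for \<open>k = 1, c, 1-c\<close> cancel, since \<open>1 = c + (1-c)\<close>.
\<close>

lemma kanter_spectral_integral:
  fixes s c :: real
  assumes "0 \<le> s" "0 < c" "c < 1"
  shows "has_bochner_integral halfline (\<lambda>x. (1 - exp (- s * x)) * (kanter_spectral c x / x))
           (ln (Gamma (1 + c * s)) + ln (Gamma (1 + (1 - c) * s)) - ln (Gamma (1 + s))
             - s * (c * ln c + (1 - c) * ln (1 - c)))"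
proof -
  let ?m = "\<lambda>c x. ((1 - exp (- s * x)) / (exp (x / c) - 1) - s * c * exp (- x)) / x"
  have "has_bochner_integral halfline (\<lambda>x. ?m 1 x - ?m c x - ?m (1 - c) x)
     ((s * (1 * ln 1) - ln (Gamma (1 + 1 * s))) - (s * (c * ln c) - ln (Gamma (1 + c * s)))
       - (s * ((1 - c) * ln (1 - c)) - ln (Gamma (1 + (1 - c) * s))))"
    using assms by (intro has_bochner_integral_diff Malmsten_rescaled) auto
  moreover have integrand: "?m 1 x - ?m c x - ?m (1 - c) x = (1 - exp (- s * x)) * (kanter_spectral c x / x)" for x
  proof -
    have alg: "(n * a - s * 1 * e) / x - (n * b - s * c * e) / x - (n * d - s * (1 - c) * e) / x
        = n * ((a - b - d) / x)" for n a b d e :: real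
      by (simp add: algebra_simps diff_divide_distrib add_divide_distrib)
    show ?thesis
      using alg[of "1 - exp (- s * x)" "1 / (exp x - 1)" "exp (- x)" "1 / (exp (x / c) - 1)"
          "1 / (exp (x / (1 - c)) - 1)"]
      by (simp add: kanter_spectral_def)
  qed
  moreover have "(s * (1 * ln 1) - ln (Gamma (1 + 1 * s))) - (s * (c * ln c) - ln (Gamma (1 + c * s)))
       - (s * ((1 - c) * ln (1 - c)) - ln (Gamma (1 + (1 - c) * s)))
     = ln (Gamma (1 + c * s)) + ln (Gamma (1 + (1 - c) * s)) - ln (Gamma (1 + s))
             - s * (c * ln c + (1 - c) * ln (1 - c))"
    by (simp add: distrib_left)
  ultimately show ?thesis
    by (simp only:)
qed

text \<open>
  Convexity of \<open>sinh\<close> on the half-line together with \<open>sinh 0 = 0\<close>.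
\<close>

lemma sinh_mult_le:
  fixes c z :: real
  assumes "0 \<le> c" "c \<le> 1" "0 \<le> z"
  shows "sinh (c * z) \<le> c * sinh z"
proof -
  have "c * sinh 0 - sinh (c * 0) \<le> c * sinh z - sinh (c * z)"
  proof (rule DERIV_nonneg_imp_nondecreasing[OF assms(3)])
    fix x :: real assume x: "0 \<le> x" "x \<le> z"
    have "cosh (c * x) \<le> cosh x"
      using x assms by (subst cosh_real_nonneg_le_iff) (auto intro: mult_left_le_one_le)
    then show "\<exists>y. ((\<lambda>x. c * sinh x - sinh (c * x)) has_real_derivative y) (at x) \<and> 0 \<le> y"
      using assms by (intro exI[of _ "c * cosh x - c * cosh (c * x)"] conjI)
        (auto intro!: derivative_eq_intros mult_left_mono)
  qed
  then show ?thesis by simp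
qed

lemma exp_div_square_eq_sinh:
  fixes z :: real
  shows "exp z / (exp z - 1)\<^sup>2 = 1 / (4 * (sinh (z / 2))\<^sup>2)"
proof -
  define w where "w = exp (z / 2)"
  have w: "w > 0" "exp z = w\<^sup>2" "exp (- (z / 2)) = 1 / w"
    by (simp_all add: w_def exp_minus field_simps power2_eq_square flip: exp_add)
  have "4 * (sinh (z / 2))\<^sup>2 = (w - 1 / w)\<^sup>2"
    by (simp add: sinh_field_def w w_def[symmetric] power2_eq_square)
  also have "\<dots> = (w\<^sup>2 - 1)\<^sup>2 / w\<^sup>2"
    using w(1) by (simp add: field_simps power2_eq_square)
  finally show ?thesis
    using w by simp
qed

text \<open>
  The map \<open>z \<mapsto> exp z / (exp z - 1)^2\<close> is minus the derivative of \<open>1/(exp z - 1)\<close>. Summing these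
  bounds for \<open>c\<close> and \<open>1-c\<close> shows that \<open>kanter_spectral c\<close> has nonpositive derivative.
\<close>

lemma exp_quotient_rescaled_le:
  fixes c x :: real
  assumes "0 < c" "c \<le> 1" "0 < x"
  shows "exp (x / c) / (exp (x / c) - 1)\<^sup>2 / c \<le> c * (exp x / (exp x - 1)\<^sup>2)"
proof -
  define A where "A = sinh (x / 2)"
  define B where "B = sinh (x / c / 2)"
  have "A \<le> c * B"
    using sinh_mult_le[of c "x / c / 2"] assms by (simp add: A_def B_def)
  moreover have "0 < A" using assms by (simp add: A_def)
  ultimately have "A\<^sup>2 \<le> (c * B)\<^sup>2" by (intro power_mono) auto
  moreover have "0 < A\<^sup>2" using \<open>0 < A\<close> by simp
  moreover have "0 < B" using assms by (simp add: B_def)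
  ultimately have "1 / (4 * B\<^sup>2) / c \<le> c * (1 / (4 * A\<^sup>2))"
    using assms(1) by (simp add: field_simps power2_eq_square)
  then show ?thesis
    by (simp add: exp_div_square_eq_sinh A_def B_def)
qed

lemma kanter_spectral_antimono:
  assumes c: "0 < c" "c < 1"
  shows "antimono_on {0<..} (kanter_spectral c)"
proof (rule monotone_onI)
  fix x y :: real assume xy: "x \<in> {0<..}" "y \<in> {0<..}" "x \<le> y"
  show "kanter_spectral c y \<le> kanter_spectral c x"
  proof (rule DERIV_nonpos_imp_nonincreasing[OF xy(3)])
    fix z :: real assume "x \<le> z" "z \<le> y"
    then have z: "0 < z" using xy by simp
    let ?d = "\<lambda>k. exp (z / k) / (exp (z / k) - 1)\<^sup>2 / k"
    have deriv: "(kanter_spectral c has_real_derivative (- ?d 1 + ?d c + ?d (1 - c))) (at z)"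
      unfolding kanter_spectral_def using c z
      by (auto intro!: derivative_eq_intros simp: power2_eq_square mult_ac)
    have "?d c \<le> c * ?d 1" "?d (1 - c) \<le> (1 - c) * ?d 1"
      using exp_quotient_rescaled_le[of c z] exp_quotient_rescaled_le[of "1 - c" z] c z by auto
    moreover have "- d + d1 + d2 \<le> 0" if "d1 \<le> c * d" "d2 \<le> (1 - c) * d" for d d1 d2 :: real
      using that by (simp add: left_diff_distrib)
    ultimately have "- ?d 1 + ?d c + ?d (1 - c) \<le> 0"
      by blast
    with deriv show "\<exists>d. (kanter_spectral c has_real_derivative d) (at z) \<and> d \<le> 0"
      by blast
  qed
qed

lemma kanter_spectral_nonneg:
  assumes c: "0 < c" "c < 1" and x: "0 < x"
  shows "0 \<le> kanter_spectral c x"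
proof (rule tendsto_upperbound)
  have lim: "((\<lambda>x. 1 / (exp (x / k) - 1)) \<longlongrightarrow> 0) at_top" if "0 < k" for k :: real
    using that by real_asymp
  have "((\<lambda>x. 1 / (exp (x / 1) - 1) - 1 / (exp (x / c) - 1) - 1 / (exp (x / (1 - c)) - 1)) \<longlongrightarrow> 0 - 0 - 0) at_top"
    using c by (intro tendsto_diff lim) auto
  then show "(kanter_spectral c \<longlongrightarrow> 0) at_top"
    by (simp add: kanter_spectral_def[abs_def])
  show "\<forall>\<^sub>F y in at_top. kanter_spectral c y \<le> kanter_spectral c x"
    using eventually_ge_at_top[of x]
  proof eventually_elim
    case (elim y)
    then show ?case
      using monotone_onD[OF kanter_spectral_antimono[OF c], of x y] x by auto
  qed
qed simp

text \<open>
  The poles \<open>1/x\<close>, \<open>c/x\<close> and \<open>(1-c)/x\<close> cancel, and each of the three terms leaves \<open>-1/2\<close> up to its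
  sign.
\<close>

lemma kanter_spectral_at_0:
  assumes c: "0 < c" "c < 1"
  shows "(kanter_spectral c \<longlongrightarrow> 1 / 2) (at_right 0)"
proof -
  have lim: "((\<lambda>x. 1 / (exp (x / k) - 1) - k / x) \<longlongrightarrow> - 1 / 2) (at_right 0)" if "0 < k" for k :: real
  proof -
    have "((\<lambda>y::real. 1 / (exp y - 1) - 1 / y) \<longlongrightarrow> - 1 / 2) (at_right 0)"
      by real_asymp
    moreover have "filterlim (\<lambda>x. x / k) (at_right 0) (at_right 0)"
      using that by real_asymp
    ultimately show ?thesis
      by (auto dest: filterlim_compose)
  qed
  have "((\<lambda>x. (1 / (exp (x / 1) - 1) - 1 / x) - (1 / (exp (x / c) - 1) - c / x)
          - (1 / (exp (x / (1 - c)) - 1) - (1 - c) / x)) \<longlongrightarrow> - 1 / 2 - (- 1 / 2) - (- 1 / 2)) (at_right 0)"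
    using c by (intro tendsto_diff lim) auto
  then show ?thesis
    by (simp add: kanter_spectral_def[abs_def] diff_divide_distrib algebra_simps)
qed

section \<open>Cauchy's cosine integral\<close>

definition cos_integral :: "real \<Rightarrow> real \<Rightarrow> real" where
  "cos_integral s t = integral {0..pi/2} (\<lambda>x. cos x powr s * cos (t * x))"

lemma cos_nonneg_quarter: "x \<in> {0..pi/2} \<Longrightarrow> 0 \<le> cos x"
  by (intro cos_ge_zero) auto

lemma continuous_on_cos_powr:
  fixes s :: real
  assumes "0 < s"
  shows "continuous_on {0..pi/2} (\<lambda>x. cos x powr s)"
  using assms cos_nonneg_quarter by (intro continuous_on_powr' continuous_intros) auto

lemma cos_powr_integrable:
  fixes s :: real and f :: "real \<Rightarrow> real"
  assumes "0 < s" "continuous_on {0..pi/2} f"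
  shows "(\<lambda>x. cos x powr s * f x) integrable_on {0..pi/2}"
  by (intro integrable_continuous_interval continuous_on_mult continuous_on_cos_powr assms)

lemma cos_integral_has_integral:
  assumes "0 < s"
  shows "((\<lambda>x. cos x powr s * cos (t * x)) has_integral cos_integral s t) {0..pi/2}"
  unfolding cos_integral_def using assms
  by (intro integrable_integral cos_powr_integrable continuous_intros)

text \<open>
  Two integrations by parts, packed into one antiderivative which vanishes at both ends.
\<close>

lemma cos_integral_plus2:
  fixes s t :: real
  assumes s: "0 < s"
  shows "((s + 2)\<^sup>2 - t\<^sup>2) * cos_integral (s + 2) t = (s + 1) * (s + 2) * cos_integral s t"
proof -
  let ?G = "\<lambda>x. cos x powr (s + 1) * ((s + 2) * sin x * cos (t * x) - t * cos x * sin (t * x))"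
  let ?g = "\<lambda>x. ((s + 2)\<^sup>2 - t\<^sup>2) * (cos x powr (s + 2) * cos (t * x))
              - (s + 1) * (s + 2) * (cos x powr s * cos (t * x))"
  have "(?g has_integral ?G (pi/2) - ?G 0) {0..pi/2}"
  proof (rule fundamental_theorem_of_calculus_interior)
    show "continuous_on {0..pi/2} ?G"
      using s by (intro continuous_on_mult continuous_on_cos_powr continuous_intros) auto
    fix x :: real assume "x \<in> {0<..<pi/2}"
    then have c: "0 < cos x" by (intro cos_gt_zero_pi) auto
    define C where "C = cos x powr s"
    have C: "cos x powr (s + 1) = C * cos x" "cos x powr (s + 2) = C * (cos x)\<^sup>2"
      using c by (simp_all add: C_def powr_add)
    have "((\<lambda>x. cos x powr (s + 1)) has_real_derivative (s + 1) * cos x powr (s + 1 - 1) * (- sin x)) (at x)"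
      using c by (intro DERIV_chain2[where f = "\<lambda>z. z powr (s + 1)"] has_real_derivative_powr DERIV_cos) auto
    moreover have "((\<lambda>x. (s + 2) * sin x * cos (t * x) - t * cos x * sin (t * x)) has_real_derivative
        (s + 2) * (cos x * cos (t * x) - t * sin x * sin (t * x))
              - t * (t * cos x * cos (t * x) - sin x * sin (t * x))) (at x)"
      by (auto intro!: derivative_eq_intros simp: algebra_simps)
    ultimately have "(?G has_real_derivative
        ((s + 1) * C * (- sin x) * ((s + 2) * sin x * cos (t * x) - t * cos x * sin (t * x))
          + C * cos x * ((s + 2) * (cos x * cos (t * x) - t * sin x * sin (t * x))
              - t * (t * cos x * cos (t * x) - sin x * sin (t * x))))) (at x)"
      by (rule DERIV_mult[THEN DERIV_cong]) (simp add: C(1), simp add: C_def mult_ac)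
    moreover have "(s + 1) * C * (- sin x) * ((s + 2) * sin x * cos (t * x) - t * cos x * sin (t * x))
          + C * cos x * ((s + 2) * (cos x * cos (t * x) - t * sin x * sin (t * x))
              - t * (t * cos x * cos (t * x) - sin x * sin (t * x))) = ?g x"
    proof -
      have sin2: "sin x * sin x = 1 - cos x * cos x"
        using sin_squared_eq[of x] by (simp add: power2_eq_square)
      have "(s + 1) * C * (- sin x) * ((s + 2) * sin x * cos (t * x) - t * cos x * sin (t * x))
          + C * cos x * ((s + 2) * (cos x * cos (t * x) - t * sin x * sin (t * x))
              - t * (t * cos x * cos (t * x) - sin x * sin (t * x)))
          = - (s + 1) * (s + 2) * C * cos (t * x) * (sin x * sin x)
            + ((s + 2) - t * t) * C * cos (t * x) * (cos x * cos x)"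
        by algebra
      also have "\<dots> = ?g x"
        unfolding C C_def[symmetric] sin2 by algebra
      finally show ?thesis .
    qed
    ultimately show "(?G has_vector_derivative ?g x) (at x)"
      by (simp only: has_real_derivative_iff_has_vector_derivative)
  qed simp
  then have "(?g has_integral 0) {0..pi/2}"
    using s by simp
  moreover have "(?g has_integral (((s + 2)\<^sup>2 - t\<^sup>2) * cos_integral (s + 2) t
      - (s + 1) * (s + 2) * cos_integral s t)) {0..pi/2}"
    using s by (intro has_integral_diff has_integral_mult_right cos_integral_has_integral) auto
  ultimately show ?thesis
    by (auto dest: has_integral_unique)
qed

lemma cos_integral_antimono:
  assumes "0 < s" "s \<le> s'"
  shows "cos_integral s' 0 \<le> cos_integral s 0"
proof (rule has_integral_le[OF cos_integral_has_integral cos_integral_has_integral])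
  fix x :: real assume "x \<in> {0..pi/2}"
  then have "0 \<le> cos x" by (rule cos_nonneg_quarter)
  then show "cos x powr s' * cos (0 * x) \<le> cos x powr s * cos (0 * x)"
    using assms by (auto intro!: powr_mono')
qed (use assms in auto)

lemma cos_integral_2: "cos_integral 2 0 = pi / 4"
proof -
  have "((\<lambda>x. (cos x)\<^sup>2) has_integral ((pi/2) / 2 + sin (2 * (pi/2)) / 4 - (0 / 2 + sin (2 * 0) / 4))) {0..pi/2::real}"
  proof (rule fundamental_theorem_of_calculus)
    fix x :: real
    show "((\<lambda>x. x / 2 + sin (2 * x) / 4) has_vector_derivative (cos x)\<^sup>2) (at x within {0..pi/2})"
      unfolding has_real_derivative_iff_has_vector_derivative[symmetric]
      by (auto intro!: derivative_eq_intros simp: cos_double_cos diff_divide_distrib)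
  qed simp
  then have "((\<lambda>x. (cos x)\<^sup>2) has_integral pi / 4) {0..pi/2::real}"
    by simp
  moreover have "((\<lambda>x. (cos x)\<^sup>2) has_integral cos_integral 2 0) {0..pi/2}"
    using cos_integral_has_integral[of 2 0]
    by (rule has_integral_eq[rotated]) (use cos_nonneg_quarter in auto)
  ultimately show ?thesis
    by (rule has_integral_unique[rotated])
qed

lemma cos_integral_pos:
  assumes "0 < s"
  shows "0 < cos_integral s 0"
proof -
  have ev: "0 < cos_integral (2 + 2 * real n) 0" for n
  proof (induction n)
    case 0 then show ?case by (simp add: cos_integral_2)
  next
    case (Suc n)
    let ?v = "2 + 2 * real n"
    have "(?v + 2)\<^sup>2 * cos_integral (?v + 2) 0 = (?v + 1) * (?v + 2) * cos_integral ?v 0"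
      using cos_integral_plus2[of ?v 0] by simp
    also have "\<dots> > 0" using Suc by (intro mult_pos_pos) auto
    finally have "0 < cos_integral (?v + 2) 0"
      by (simp add: zero_less_mult_iff)
    then show ?case by (simp add: algebra_simps)
  qed
  obtain n where "s \<le> real n" using real_arch_simple by blast
  then have "cos_integral (2 + 2 * real n) 0 \<le> cos_integral s 0"
    using assms by (intro cos_integral_antimono) auto
  with ev[of n] show ?thesis by simp
qed

lemma cos_integral_ratio:
  assumes "0 < s"
  shows "cos_integral (s + 2) 0 / cos_integral s 0 = (s + 1) / (s + 2)"
proof -
  have "(s + 2) * ((s + 2) * cos_integral (s + 2) 0) = (s + 2) * ((s + 1) * cos_integral s 0)"
    using cos_integral_plus2[OF assms, of 0] by (simp add: power2_eq_square algebra_simps)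
  then have "(s + 2) * cos_integral (s + 2) 0 = (s + 1) * cos_integral s 0"
    using assms by simp
  then show ?thesis
    using assms cos_integral_pos[OF assms] by (simp add: field_simps)
qed

text \<open>
  For large \<open>s\<close> the mass of \<open>cos^s\<close> concentrates at \<open>0\<close>, where \<open>cos(tx)\<close> is close to \<open>1\<close>. The loss is at
  most \<open>t^2 x^2 / 2\<close>, and \<open>x cos x \<le> sin x\<close> converts \<open>x^2 cos^2 x\<close> into \<open>1 - cos^2 x\<close>, so that the
  error is again expressed by cosine integrals.
\<close>

lemma cos_integral_concentration:
  fixes s t :: real
  assumes s: "0 < s"
  shows "\<bar>cos_integral (s + 2) t - cos_integral (s + 2) 0\<bar> \<le> t\<^sup>2 / 2 * (cos_integral (s + 2) 0 / (s + 1))"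
proof -
  have eq: "cos_integral s 0 - cos_integral (s + 2) 0 = cos_integral (s + 2) 0 / (s + 1)"
    using cos_integral_ratio[OF s] s cos_integral_pos[OF s] by (simp add: field_simps)
  have int: "((\<lambda>x. cos x powr (s + 2) * cos (0 * x) - cos x powr (s + 2) * cos (t * x)) has_integral
      (cos_integral (s + 2) 0 - cos_integral (s + 2) t)) {0..pi/2}"
    using s by (intro has_integral_diff cos_integral_has_integral) auto
  have "0 \<le> cos_integral (s + 2) 0 - cos_integral (s + 2) t"
    using int by (rule has_integral_nonneg) (auto intro: mult_left_le)
  moreover have "cos_integral (s + 2) 0 - cos_integral (s + 2) t
      \<le> t\<^sup>2 / 2 * (cos_integral s 0 - cos_integral (s + 2) 0)"
  proof (rule has_integral_le[OF int])
    show "((\<lambda>x. t\<^sup>2 / 2 * (cos x powr s * cos (0 * x) - cos x powr (s + 2) * cos (0 * x))) has_integral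
        t\<^sup>2 / 2 * (cos_integral s 0 - cos_integral (s + 2) 0)) {0..pi/2}"
      using s by (intro has_integral_mult_right has_integral_diff cos_integral_has_integral) auto
    fix x :: real assume x: "x \<in> {0..pi/2}"
    have c: "0 \<le> cos x" using x by (rule cos_nonneg_quarter)
    have "x * cos x \<le> sin x"
    proof (cases "x = pi/2")
      case True
      show ?thesis unfolding True by simp
    next
      case False
      then have "0 < cos x" "x \<le> \<bar>tan x\<bar>" "0 \<le> sin x"
        using x abs_tan_ge[of x] by (auto intro!: cos_gt_zero_pi sin_ge_zero)
      then show ?thesis by (simp add: tan_def field_simps)
    qed
    then have xc: "(x * cos x)\<^sup>2 \<le> (sin x)\<^sup>2"
      using x c by (intro power_mono) auto
    have "1 - cos (t * x) = 2 * (sin (t * x / 2))\<^sup>2"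
      using cos_double_sin[of "t * x / 2"] by simp
    also have "(sin (t * x / 2))\<^sup>2 \<le> (t * x / 2)\<^sup>2"
      unfolding abs_le_square_iff[symmetric] by (rule abs_sin_x_le_abs_x)
    finally have le: "1 - cos (t * x) \<le> t\<^sup>2 / 2 * x\<^sup>2"
      by (simp add: power_mult_distrib power_divide)
    have "cos x powr (s + 2) - cos x powr (s + 2) * cos (t * x) = cos x powr s * ((cos x)\<^sup>2 * (1 - cos (t * x)))"
      using c by (simp add: powr_add algebra_simps)
    also have "\<dots> \<le> cos x powr s * ((cos x)\<^sup>2 * (t\<^sup>2 / 2 * x\<^sup>2))"
      by (intro mult_left_mono le) auto
    also have "\<dots> = t\<^sup>2 / 2 * (cos x powr s * (x * cos x)\<^sup>2)"
      by (simp add: power_mult_distrib)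
    also have "\<dots> \<le> t\<^sup>2 / 2 * (cos x powr s * (sin x)\<^sup>2)"
      by (intro mult_left_mono xc) auto
    also have "\<dots> = t\<^sup>2 / 2 * (cos x powr s - cos x powr (s + 2))"
      using c by (simp add: powr_add sin_squared_eq algebra_simps)
    finally show "cos x powr (s + 2) * cos (0 * x) - cos x powr (s + 2) * cos (t * x)
      \<le> t\<^sup>2 / 2 * (cos x powr s * cos (0 * x) - cos x powr (s + 2) * cos (0 * x))"
      by simp
  qed
  ultimately show ?thesis
    unfolding eq by simp
qed

lemma cos_integral_limit:
  fixes s t :: real
  assumes s: "0 < s"
  shows "(\<lambda>n. cos_integral (s + 2 * real n) t / cos_integral (s + 2 * real n) 0) \<longlonglongrightarrow> 1"
proof (rule LIMSEQ_imp_Suc, rule Lim_null[THEN iffD2], rule Lim_null_comparison)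
  show "\<forall>\<^sub>F n in sequentially. norm (cos_integral (s + 2 * real (Suc n)) t / cos_integral (s + 2 * real (Suc n)) 0 - 1)
      \<le> t\<^sup>2 / 2 * (1 / (s + 2 * real n + 1))"
  proof (intro always_eventually allI)
    fix n
    let ?v = "s + 2 * real n"
    have v: "s + 2 * real (Suc n) = ?v + 2" by simp
    have p: "0 < cos_integral (?v + 2) 0" using s by (intro cos_integral_pos) auto
    have "\<bar>cos_integral (?v + 2) t - cos_integral (?v + 2) 0\<bar> / cos_integral (?v + 2) 0
        \<le> t\<^sup>2 / 2 * (cos_integral (?v + 2) 0 / (?v + 1)) / cos_integral (?v + 2) 0"
      using s p by (intro divide_right_mono cos_integral_concentration) auto
    moreover have "\<bar>cos_integral (?v + 2) t - cos_integral (?v + 2) 0\<bar> / cos_integral (?v + 2) 0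
        = \<bar>cos_integral (?v + 2) t / cos_integral (?v + 2) 0 - 1\<bar>"
      using p by (simp add: field_simps abs_if)
    ultimately show "norm (cos_integral (s + 2 * real (Suc n)) t / cos_integral (s + 2 * real (Suc n)) 0 - 1)
      \<le> t\<^sup>2 / 2 * (1 / (s + 2 * real n + 1))"
      unfolding v using p by simp
  qed
  show "(\<lambda>n. t\<^sup>2 / 2 * (1 / (s + 2 * real n + 1))) \<longlonglongrightarrow> 0"
    by real_asymp
qed

text \<open>
  Gauss's limit for \<open>\<Gamma>(p)\<close>, read as an asymptotic formula for \<open>\<Gamma>(1 + p + n)\<close>.
\<close>

lemma Gamma_shift_asymp:
  fixes p :: real
  assumes p: "0 < p"
  shows "(\<lambda>n. Gamma (1 + p + real n) / (fact n * real n powr p)) \<longlonglongrightarrow> 1"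
proof -
  from p have np: "p \<notin> \<int>\<^sub>\<le>\<^sub>0" by (auto elim!: nonpos_Ints_cases)
  have G: "0 < Gamma p" using p by (rule Gamma_real_pos)
  have "(\<lambda>n. Gamma p / Gamma_series p n) \<longlonglongrightarrow> Gamma p / Gamma p"
    using G by (intro tendsto_intros) auto
  then have "(\<lambda>n. Gamma p / Gamma_series p n) \<longlonglongrightarrow> 1"
    using G by simp
  moreover have "\<forall>\<^sub>F n in sequentially. Gamma p / Gamma_series p n = Gamma (1 + p + real n) / (fact n * real n powr p)"
    using eventually_gt_at_top[of 0]
  proof eventually_elim
    case (elim n)
    have "pochhammer p (n + 1) = Gamma (1 + p + real n) / Gamma p"
      using pochhammer_Gamma[OF np, of "n + 1"] by (simp add: algebra_simps)
    then show ?case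
      using elim G by (simp add: Gamma_series_def powr_def field_simps)
  qed
  ultimately show ?thesis
    by (rule Lim_transform_eventually)
qed

text \<open>
  The normalisation for which the product of \<open>cos_integral s t\<close> and \<open>gamma_factor s t\<close> is invariant
  under \<open>s \<mapsto> s + 2\<close>; Cauchy's formula says that this product is constantly \<open>\<pi>/2\<close>.
\<close>

definition gamma_factor :: "real \<Rightarrow> real \<Rightarrow> real" where
  "gamma_factor s t = 2 powr s * Gamma (1 + (s + t) / 2) * Gamma (1 + (s - t) / 2) / Gamma (1 + s)"

lemma gamma_factor_pos: "\<bar>t\<bar> < s \<Longrightarrow> 0 < gamma_factor s t"
  unfolding gamma_factor_def
  by (intro divide_pos_pos mult_pos_pos Gamma_real_pos) (auto simp: field_simps)

lemma gamma_factor_plus2: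
  assumes "\<bar>t\<bar> < s"
  shows "gamma_factor (s + 2) t * ((s + 1) * (s + 2)) = gamma_factor s t * ((s + 2)\<^sup>2 - t\<^sup>2)"
proof -
  have step: "Gamma (z + 1) = z * Gamma z" if "0 < z" for z :: real
    using that by (intro Gamma_plus1) (auto elim!: nonpos_Ints_cases)
  have "Gamma (1 + (s + 2 + t) / 2) = (1 + (s + t) / 2) * Gamma (1 + (s + t) / 2)"
    using step[of "1 + (s + t) / 2"] assms by (simp add: add_divide_distrib algebra_simps)
  moreover have "Gamma (1 + (s + 2 - t) / 2) = (1 + (s - t) / 2) * Gamma (1 + (s - t) / 2)"
    using step[of "1 + (s - t) / 2"] assms by (simp add: add_divide_distrib diff_divide_distrib algebra_simps)
  moreover have "Gamma (1 + (s + 2)) = (s + 2) * ((s + 1) * Gamma (1 + s))"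
    using step[of "1 + s"] step[of "1 + s + 1"] assms by (simp add: algebra_simps)
  moreover have "(2::real) powr (s + 2) = 4 * 2 powr s"
    by (simp add: powr_add)
  ultimately have "gamma_factor (s + 2) t = 4 * 2 powr s * ((1 + (s + t) / 2) * Gamma (1 + (s + t) / 2)) *
      ((1 + (s - t) / 2) * Gamma (1 + (s - t) / 2)) / ((s + 2) * ((s + 1) * Gamma (1 + s)))"
    by (simp only: gamma_factor_def)
  also have "\<dots> * ((s + 1) * (s + 2)) = 4 * 2 powr s * ((1 + (s + t) / 2) * Gamma (1 + (s + t) / 2)) *
      ((1 + (s - t) / 2) * Gamma (1 + (s - t) / 2)) / Gamma (1 + s)"
  proof -
    have "s + 1 \<noteq> 0" "s + 2 \<noteq> 0" using assms by auto
    then show ?thesis by simp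
  qed
  also have "\<dots> = gamma_factor s t * (4 * (1 + (s + t) / 2) * (1 + (s - t) / 2))"
    by (simp add: gamma_factor_def)
  also have "4 * (1 + (s + t) / 2) * (1 + (s - t) / 2) = (s + 2)\<^sup>2 - t\<^sup>2"
    by (simp add: power2_eq_square field_simps)
  finally show ?thesis .
qed

text \<open>
  The point is that the comparison sequence depends neither on \<open>s\<close> nor on \<open>t\<close>: the powers of \<open>n\<close>
  from the numerator and the denominator cancel because \<open>(s+t)/2 + (s-t)/2 = s\<close>.
\<close>

lemma gamma_factor_asymp:
  assumes st: "\<bar>t\<bar> < s"
  shows "(\<lambda>n. gamma_factor (s + 2 * real n) t / ((fact n)\<^sup>2 * 4 ^ n / fact (2 * n))) \<longlonglongrightarrow> 1"
proof -
  let ?A = "\<lambda>p n. Gamma (1 + p + real n) / (fact n * real n powr p)"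
  let ?p = "(s + t) / 2" and ?q = "(s - t) / 2"
  have "filterlim (\<lambda>n::nat. 2 * n) at_top at_top"
    by (intro filterlim_subseq) (auto simp: strict_mono_def)
  then have "(\<lambda>n. ?A s (2 * n)) \<longlonglongrightarrow> 1"
    using st by (intro filterlim_compose[OF Gamma_shift_asymp]) auto
  then have "(\<lambda>n. ?A ?p n * ?A ?q n / ?A s (2 * n)) \<longlonglongrightarrow> 1 * 1 / 1"
    using st by (intro tendsto_intros Gamma_shift_asymp) auto
  moreover have "\<forall>\<^sub>F n in sequentially. ?A ?p n * ?A ?q n / ?A s (2 * n)
      = gamma_factor (s + 2 * real n) t / ((fact n)\<^sup>2 * 4 ^ n / fact (2 * n))"
    using eventually_gt_at_top[of 0]
  proof eventually_elim
    case (elim n)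
    have 1: "1 + (s + 2 * real n + t) / 2 = 1 + ?p + real n" "1 + (s + 2 * real n - t) / 2 = 1 + ?q + real n"
      by (simp_all add: field_simps)
    have 2: "real n powr ?p * real n powr ?q = real n powr s"
      by (simp flip: powr_add add: field_simps)
    have 3: "(2::real) powr (s + 2 * real n) = 2 powr s * 4 ^ n"
      by (simp add: powr_add powr_realpow flip: powr_powr)
    have 4: "real (2 * n) powr s = 2 powr s * real n powr s"
      by (simp add: powr_mult)
    have pos: "0 < Gamma (1 + s + real (2 * n))" "0 < (2::real) powr s" "0 < real n powr s"
        "real n powr ?p > 0" "real n powr ?q > 0"
      using st elim by (auto intro!: Gamma_real_pos)
    have "?A ?p n * ?A ?q n / ?A s (2 * n)
      = Gamma (1 + ?p + real n) * Gamma (1 + ?q + real n) * (fact (2 * n) * real (2 * n) powr s)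
        / ((fact n)\<^sup>2 * (real n powr ?p * real n powr ?q) * Gamma (1 + s + real (2 * n)))"
      by (simp add: power2_eq_square)
    also have "\<dots> = Gamma (1 + ?p + real n) * Gamma (1 + ?q + real n) * (fact (2 * n) * 2 powr s)
        / ((fact n)\<^sup>2 * Gamma (1 + s + real (2 * n)))"
      unfolding 2 4 using pos(3) by simp
    also have "\<dots> = gamma_factor (s + 2 * real n) t / ((fact n)\<^sup>2 * 4 ^ n / fact (2 * n))"
      unfolding gamma_factor_def 1 3 by (simp add: add.assoc mult_ac)
    finally show ?case .
  qed
  ultimately show ?thesis
    by (auto intro: Lim_transform_eventually)
qed

lemma cos_integral_gamma_factor_periodic:
  assumes "\<bar>t\<bar> < s"
  shows "cos_integral (s + 2 * real n) t * gamma_factor (s + 2 * real n) t = cos_integral s t * gamma_factor s t"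
proof (induction n)
  case (Suc n)
  let ?v = "s + 2 * real n"
  have v: "\<bar>t\<bar> < ?v" using assms by simp
  then have "0 < (?v + 2 - \<bar>t\<bar>) * (?v + 2 + \<bar>t\<bar>)" by (intro mult_pos_pos) auto
  then have nz1: "(?v + 2)\<^sup>2 - t\<^sup>2 \<noteq> 0"
    by (auto simp: power2_eq_square algebra_simps abs_mult_self_eq)
  have nz2: "(?v + 1) * (?v + 2) \<noteq> 0"
    using v by auto
  have eqs: "((?v + 2)\<^sup>2 - t\<^sup>2) * cos_integral (?v + 2) t = (?v + 1) * (?v + 2) * cos_integral ?v t"
    "gamma_factor (?v + 2) t * ((?v + 1) * (?v + 2)) = gamma_factor ?v t * ((?v + 2)\<^sup>2 - t\<^sup>2)"
    using cos_integral_plus2[of ?v t] gamma_factor_plus2[OF v] v by auto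
  have "C1 * G1 = C * G" if "d * C1 = e * C" "G1 * e = G * d" "d \<noteq> 0" "e \<noteq> 0" for C C1 G G1 d e :: real
  proof -
    have "d * e * (C1 * G1) = (d * C1) * (G1 * e)" by simp
    also have "\<dots> = d * e * (C * G)" unfolding that(1,2) by simp
    finally show ?thesis using that(3,4) by simp
  qed
  from this[OF eqs nz1 nz2] Suc show ?case
    by (simp add: algebra_simps)
qed simp

text \<open>
  Cauchy's integral. The product \<open>R(s, t)\<close> of \<open>cos_integral s t\<close> and \<open>gamma_factor s t\<close> has period
  \<open>2\<close> in \<open>s\<close>, so it suffices to compare \<open>R(s + 2n, t)\<close> with the known value of \<open>R\<close> at even integers
  and \<open>t = 0\<close> as \<open>n\<close> grows. In the limit \<open>t\<close> becomes invisible by concentration, and \<open>s\<close> may be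
  replaced by an even integer at distance at most \<open>2\<close> by monotonicity, since the ratio of neighbouring
  cosine integrals tends to \<open>1\<close>.
\<close>

theorem cos_integral_eq:
  assumes st: "\<bar>t\<bar> < s"
  shows "cos_integral s t = pi / (2 * gamma_factor s t)"
proof -
  let ?W = "\<lambda>n. (fact n)\<^sup>2 * 4 ^ n / fact (2 * n) :: real"
  let ?R = "\<lambda>s t. cos_integral s t * gamma_factor s t"
  have W: "?W n \<noteq> 0" for n by simp
  have R2: "?R 2 0 = pi / 2"
    by (simp add: cos_integral_2 gamma_factor_def Gamma_fact[of 2, simplified] Gamma_fact[of 1, simplified])
  \<comment> \<open>The shift makes room for an even integer \<open>m\<close> with \<open>2 \<le> m \<le> v \<le> m + 2\<close>.\<close>
  define v where "v = s + 2"
  have v: "2 < v" "\<bar>t\<bar> < v" using st by (auto simp: v_def)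
  define j where "j = nat \<lfloor>v / 2\<rfloor> - 1"
  define m where "m = 2 + 2 * real j"
  have "1 \<le> \<lfloor>v / 2\<rfloor>" using v by simp
  moreover have "int (nat f - 1) = f - 1" if "1 \<le> f" for f
    using that by simp
  ultimately have "int j = \<lfloor>v / 2\<rfloor> - 1" unfolding j_def by blast
  then have "real j = of_int \<lfloor>v / 2\<rfloor> - 1" by linarith
  then have m: "m \<le> v" "v \<le> m + 2" by (auto simp: m_def) linarith+
  have m2: "2 \<le> m" by (simp add: m_def)
  have Rm: "?R m 0 = pi / 2"
    using cos_integral_gamma_factor_periodic[of 0 2 j] R2 by (simp add: m_def)
  let ?vn = "\<lambda>n. v + 2 * real n" and ?mn = "\<lambda>n. m + 2 * real n"
  have squeeze: "(\<lambda>n. cos_integral (?vn n) 0 / cos_integral (?mn n) 0) \<longlonglongrightarrow> 1"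
  proof (rule tendsto_sandwich)
    show "\<forall>\<^sub>F n in sequentially. (?mn n + 1) / (?mn n + 2) \<le> cos_integral (?vn n) 0 / cos_integral (?mn n) 0"
    proof (intro always_eventually allI)
      fix n
      have "(?mn n + 1) / (?mn n + 2) = cos_integral (?mn n + 2) 0 / cos_integral (?mn n) 0"
        using m2 by (intro cos_integral_ratio[symmetric]) auto
      also have "\<dots> \<le> cos_integral (?vn n) 0 / cos_integral (?mn n) 0"
        using m m2 v by (intro divide_right_mono cos_integral_antimono less_imp_le[OF cos_integral_pos]) auto
      finally show "(?mn n + 1) / (?mn n + 2) \<le> cos_integral (?vn n) 0 / cos_integral (?mn n) 0" .
    qed
    show "\<forall>\<^sub>F n in sequentially. cos_integral (?vn n) 0 / cos_integral (?mn n) 0 \<le> 1"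
    proof (intro always_eventually allI)
      fix n
      have "0 < ?mn n" "?mn n \<le> ?vn n" using m m2 by auto
      then show "cos_integral (?vn n) 0 / cos_integral (?mn n) 0 \<le> 1"
        using cos_integral_antimono[of "?mn n" "?vn n"] cos_integral_pos[of "?mn n"] by simp
    qed
    show "(\<lambda>n. (?mn n + 1) / (?mn n + 2)) \<longlonglongrightarrow> 1"
      by real_asymp
  qed simp
  have "(\<lambda>n. (cos_integral (?vn n) t / cos_integral (?vn n) 0) * (cos_integral (?vn n) 0 / cos_integral (?mn n) 0)
      * ((gamma_factor (?vn n) t / ?W n) / (gamma_factor (?mn n) 0 / ?W n))) \<longlonglongrightarrow> 1 * 1 * (1 / 1)"
    using v m2 by (intro tendsto_mult tendsto_divide squeeze cos_integral_limit gamma_factor_asymp) auto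
  moreover have "(cos_integral (?vn n) t / cos_integral (?vn n) 0) * (cos_integral (?vn n) 0 / cos_integral (?mn n) 0)
      * ((gamma_factor (?vn n) t / ?W n) / (gamma_factor (?mn n) 0 / ?W n)) = ?R v t / (pi / 2)" for n
  proof -
    have "cos_integral (?vn n) 0 \<noteq> 0"
      using cos_integral_pos[of "?vn n"] v by simp
    then have "(cos_integral (?vn n) t / cos_integral (?vn n) 0) * (cos_integral (?vn n) 0 / cos_integral (?mn n) 0)
      * ((gamma_factor (?vn n) t / ?W n) / (gamma_factor (?mn n) 0 / ?W n)) = ?R (?vn n) t / ?R (?mn n) 0"
      by simp
    also have "?R (?vn n) t = ?R v t"
      using v by (intro cos_integral_gamma_factor_periodic) auto
    also have "?R (?mn n) 0 = ?R m 0"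
      using m2 by (intro cos_integral_gamma_factor_periodic) auto
    finally show ?thesis unfolding Rm .
  qed
  ultimately have "(\<lambda>n::nat. ?R v t / (pi / 2)) \<longlonglongrightarrow> 1"
    by simp
  then have "?R v t / (pi / 2) = 1"
    by (simp add: LIMSEQ_const_iff)
  then have "?R s t = pi / 2"
    using cos_integral_gamma_factor_periodic[OF st, of 1] by (simp add: v_def)
  then show ?thesis
    using gamma_factor_pos[OF st] by (simp add: field_simps)
qed

section \<open>Fractional moments by contour deformation\<close>

text \<open>
  The plane slit along the negative half-axis, seen in the logarithmic coordinate
  \<open>w = log z\<close>. Its convexity yields a global primitive of every holomorphic function.
\<close>

definition strip :: "complex set" where
  "strip = {w. \<bar>Im w\<bar> < pi}"

lemma open_strip: "open strip"
proof -
  have eq: "strip = Im -` {- pi<..<pi}" by (auto simp: strip_def)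
  show ?thesis unfolding eq by (intro open_vimage open_greaterThanLessThan continuous_intros)
qed

lemma convex_strip: "convex strip"
proof -
  have "strip = {w. Im w < pi} \<inter> {w. - pi < Im w}" by (auto simp: strip_def)
  then show ?thesis by (metis convex_Int convex_halfspace_Im_lt convex_halfspace_Im_gt)
qed

lemma one_plus_exp_strip:
  assumes "w \<in> strip"
  shows "1 + exp w \<notin> \<real>\<^sub>\<le>\<^sub>0"
proof
  assume *: "1 + exp w \<in> \<real>\<^sub>\<le>\<^sub>0"
  then have "exp (Re w) * sin (Im w) = 0" by (simp add: complex_nonpos_Reals_iff Im_exp)
  then have "sin (Im w) = 0" by simp
  then have "Im w = 0"
    using assms sin_gt_zero[of "Im w"] sin_gt_zero[of "- Im w"] by (cases "Im w = 0") (auto simp: strip_def abs_less_iff neq_iff)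
  moreover have "0 < 1 + exp (Re w)" by (intro add_pos_pos) auto
  ultimately show False using * by (simp add: complex_nonpos_Reals_iff Re_exp)
qed

text \<open>
  The function \<open>(1 + z)^s z^(-cs)\<close> at \<open>z = exp w\<close>; integrating it against \<open>dw = dz/z\<close> around the origin
  gives binomial coefficients.
\<close>

definition binom_integrand :: "real \<Rightarrow> real \<Rightarrow> complex \<Rightarrow> complex" where
  "binom_integrand c s w = exp (of_real s * (Ln (1 + exp w) - of_real c * w))"

lemma binom_integrand_holomorphic: "binom_integrand c s holomorphic_on strip"
proof -
  have "(\<lambda>w. Ln (1 + exp w)) holomorphic_on strip"
    using one_plus_exp_strip by (intro holomorphic_on_Ln' holomorphic_intros) blast
  then have "(\<lambda>w. exp (of_real s * (Ln (1 + exp w) - of_real c * w))) holomorphic_on strip"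
    by (intro holomorphic_on_exp' holomorphic_on_mult holomorphic_on_diff holomorphic_on_const holomorphic_on_ident)
  then show ?thesis
    by (simp add: binom_integrand_def[abs_def])
qed

lemma binom_integrand_primitive:
  obtains P where "\<And>w. w \<in> strip \<Longrightarrow> (P has_field_derivative binom_integrand c s w) (at w)"
proof -
  obtain P where "\<And>w. w \<in> strip \<Longrightarrow> (P has_field_derivative binom_integrand c s w) (at w within strip)"
    using holomorphic_convex_primitive'[OF convex_strip open_strip binom_integrand_holomorphic] by metis
  then show ?thesis
    using that at_within_open[OF _ open_strip] by metis
qed

lemma binom_integrand_real: "binom_integrand c s (of_real x) \<in> \<real>"
proof -
  have "0 < 1 + exp x" by (intro add_pos_pos) auto
  then have "Ln (of_real (1 + exp x)) = of_real (ln (1 + exp x))" by (rule Ln_of_real)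
  then have "Ln (1 + exp (of_real x)) = of_real (ln (1 + exp x))" by (simp flip: exp_of_real)
  then have "binom_integrand c s (of_real x) = of_real (exp (s * (ln (1 + exp x) - c * x)))"
    by (simp add: binom_integrand_def flip: exp_of_real)
  then show ?thesis by simp
qed

lemma norm_binom_integrand_le:
  assumes "0 \<le> s" "0 \<le> c" "\<bar>Re w\<bar> \<le> 1" "w \<in> strip"
  shows "norm (binom_integrand c s w) \<le> exp (s * (ln (1 + exp 1) + c))"
proof -
  have nz: "1 + exp w \<noteq> 0" using one_plus_exp_strip[OF assms(4)] by auto
  have "norm (1 + exp w) \<le> 1 + exp (Re w)"
    using norm_triangle_ineq[of 1 "exp w"] by simp
  also have "\<dots> \<le> 1 + exp 1" using assms by simp
  finally have "ln (norm (1 + exp w)) \<le> ln (1 + exp 1)"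
    using nz by (subst ln_le_cancel_iff) (auto intro!: add_pos_pos)
  moreover have "- (c * Re w) \<le> c"
    using mult_left_mono[of "- Re w" 1 c] assms by simp
  ultimately have "s * (ln (norm (1 + exp w)) - c * Re w) \<le> s * (ln (1 + exp 1) + c)"
    using assms by (intro mult_left_mono) auto
  then show ?thesis
    using nz by (simp add: binom_integrand_def)
qed

text \<open>
  On the unit circle, half the argument is the natural parameter:
  \<open>1 + exp(2ix) = 2 cos x exp(ix)\<close>.
\<close>

lemma binom_integrand_imaginary:
  assumes "0 \<le> x" "x < pi / 2"
  shows "Re (binom_integrand c s (Complex 0 (2 * x))) = 2 powr s * (cos x powr s * cos (s * (1 - 2 * c) * x))"
proof -
  have cx: "0 < cos x" using assms by (intro cos_gt_zero_pi) auto
  have "1 + exp (Complex 0 (2 * x)) = exp (Complex (ln (2 * cos x)) x)"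
  proof (rule complex_eqI)
    show "Re (1 + exp (Complex 0 (2 * x))) = Re (exp (Complex (ln (2 * cos x)) x))"
      using cx by (simp add: Re_exp cos_double_cos power2_eq_square)
    show "Im (1 + exp (Complex 0 (2 * x))) = Im (exp (Complex (ln (2 * cos x)) x))"
      using cx by (simp add: Im_exp sin_double)
  qed
  then have "Ln (1 + exp (Complex 0 (2 * x))) = Complex (ln (2 * cos x)) x"
    using assms by (simp add: Ln_exp)
  then have "Re (binom_integrand c s (Complex 0 (2 * x))) = exp (s * ln (2 * cos x)) * cos (s * (x - c * (2 * x)))"
    by (simp add: binom_integrand_def Re_exp)
  also have "exp (s * ln (2 * cos x)) = 2 powr s * cos x powr s"
    using cx by (simp add: powr_def ln_mult distrib_left exp_add)
  finally show ?thesis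
    by (simp add: algebra_simps)
qed

text \<open>
  The real part of \<open>log z\<close> as a function of the argument \<open>\<theta>\<close> of \<open>z\<close> on the curve where
  \<open>arg(1 + z) = c \<theta>\<close>: by the law of sines in the triangle \<open>0, 1, 1 + z\<close>,
  \<open>|z| = sin(c\<theta>) / sin((1-c)\<theta>)\<close> and \<open>|1 + z| = sin \<theta> / sin((1-c)\<theta>)\<close>.
\<close>

definition kanter_curve :: "real \<Rightarrow> real \<Rightarrow> real" where
  "kanter_curve c \<theta> = ln (sin (c * \<theta>) / sin ((1 - c) * \<theta>))"

lemma kanter_sin_pos:
  assumes "0 < c" "c < 1" "0 < \<theta>" "\<theta> < pi"
  shows "0 < sin \<theta>" "0 < sin (c * \<theta>)" "0 < sin ((1 - c) * \<theta>)"
proof -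
  have "c * \<theta> < 1 * pi" "(1 - c) * \<theta> < 1 * pi"
    using assms by (intro mult_strict_mono; simp)+
  then show "0 < sin \<theta>" "0 < sin (c * \<theta>)" "0 < sin ((1 - c) * \<theta>)"
    using assms by (auto intro!: sin_gt_zero)
qed

text \<open>
  The arguments of \<open>(1+z)^s\<close> and \<open>z^(cs)\<close> agree on the curve, so only the moduli remain.
\<close>

lemma binom_integrand_kanter_curve:
  assumes c: "0 < c" "c < 1" and \<theta>: "0 < \<theta>" "\<theta> < pi"
  shows "binom_integrand c s (Complex (kanter_curve c \<theta>) \<theta>) = of_real (kanter_b c (\<theta> / pi) powr s)"
proof -
  define A where "A = sin (c * \<theta>)"
  define B where "B = sin ((1 - c) * \<theta>)"
  define S where "S = sin \<theta>"
  have pos: "0 < S" "0 < A" "0 < B"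
    using kanter_sin_pos[OF assms] by (simp_all add: A_def B_def S_def)
  have B_eq: "B = sin \<theta> * cos (c * \<theta>) - cos \<theta> * sin (c * \<theta>)"
    using sin_diff[of \<theta> "c * \<theta>"] by (simp add: B_def left_diff_distrib)
  let ?w = "Complex (kanter_curve c \<theta>) \<theta>"
  have x: "exp (kanter_curve c \<theta>) = A / B" "kanter_curve c \<theta> = ln A - ln B"
    using pos by (simp_all add: kanter_curve_def ln_div exp_diff flip: A_def B_def)
  have "1 + exp ?w = exp (Complex (ln (S / B)) (c * \<theta>))"
  proof (rule complex_eqI)
    show "Re (1 + exp ?w) = Re (exp (Complex (ln (S / B)) (c * \<theta>)))"
      using pos by (simp add: Re_exp x(1) field_simps) (simp add: B_eq S_def A_def algebra_simps)
    show "Im (1 + exp ?w) = Im (exp (Complex (ln (S / B)) (c * \<theta>)))"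
      using pos by (simp add: Im_exp x(1)) (simp add: S_def A_def)
  qed
  moreover have "c * \<theta> < 1 * pi"
    using assms by (intro mult_strict_mono) auto
  moreover have "- pi < c * \<theta>"
    using assms by (intro less_trans[OF _ mult_pos_pos]) auto
  ultimately have "Ln (1 + exp ?w) = Complex (ln (S / B)) (c * \<theta>)"
    by (simp add: Ln_exp)
  then have "of_real s * (Ln (1 + exp ?w) - of_real c * ?w) = of_real (s * (ln (S / B) - c * kanter_curve c \<theta>))"
    by (simp add: complex_eq_iff)
  then have "binom_integrand c s ?w = of_real (exp (s * (ln (S / B) - c * kanter_curve c \<theta>)))"
    by (simp only: binom_integrand_def exp_of_real)
  also have "exp (s * (ln (S / B) - c * kanter_curve c \<theta>)) = kanter_b c (\<theta> / pi) powr s"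
  proof -
    have "kanter_b c (\<theta> / pi) = S / (A powr c * B powr (1 - c))"
      by (simp add: kanter_b_def A_def B_def S_def mult_ac)
    also have "\<dots> = exp (ln (S / B) - c * kanter_curve c \<theta>)"
      using pos by (simp add: x(2) powr_def ln_div exp_diff exp_add[symmetric] field_simps)
        (simp add: exp_diff exp_add field_simps)
    finally show ?thesis by (simp add: powr_def)
  qed
  finally show ?thesis .
qed

lemma kanter_curve_at_0:
  assumes c: "0 < c" "c < 1"
  shows "(kanter_curve c \<longlongrightarrow> ln (c / (1 - c))) (at_right 0)"
proof -
  have "((\<lambda>\<theta>. sin (c * \<theta>) / sin ((1 - c) * \<theta>)) \<longlongrightarrow> c / (1 - c)) (at_right 0)"
  proof -
    have lim: "((\<lambda>\<theta>. sin (k * \<theta>) / \<theta>) \<longlongrightarrow> k) (at_right 0)" if "0 < k" for k :: real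
      using that by real_asymp
    have "((\<lambda>\<theta>. (sin (c * \<theta>) / \<theta>) / (sin ((1 - c) * \<theta>) / \<theta>)) \<longlongrightarrow> c / (1 - c)) (at_right 0)"
      using c by (intro tendsto_divide lim) auto
    moreover have "\<forall>\<^sub>F \<theta> in at_right 0. (sin (c * \<theta>) / \<theta>) / (sin ((1 - c) * \<theta>) / \<theta>) = sin (c * \<theta>) / sin ((1 - c) * \<theta>)"
      using eventually_at_right_less[of "0::real"] by eventually_elim simp
    ultimately show ?thesis by (rule Lim_transform_eventually)
  qed
  then show ?thesis
    unfolding kanter_curve_def[abs_def] using c by (intro tendsto_ln) auto
qed

lemma kanter_curve_at_pi:
  assumes c: "0 < c" "c < 1"
  shows "(kanter_curve c \<longlongrightarrow> 0) (at_left pi)"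
proof -
  have "0 < sin (c * pi)"
    using c by (intro sin_gt_zero) auto
  moreover have "sin ((1 - c) * pi) = sin (c * pi)"
    using sin_diff[of pi "c * pi"] by (simp add: left_diff_distrib)
  ultimately have "((\<lambda>\<theta>. ln (sin (c * \<theta>) / sin ((1 - c) * \<theta>))) \<longlongrightarrow> ln (sin (c * pi) / sin ((1 - c) * pi))) (at_left pi)"
    by (intro tendsto_intros) auto
  with \<open>0 < sin (c * pi)\<close> \<open>sin ((1 - c) * pi) = _\<close> show ?thesis
    by (simp add: kanter_curve_def[abs_def])
qed

text \<open>
  Integration up along the upper half of the unit circle; the limit avoids the end point \<open>\<pi>i\<close>, which lies
  on the boundary of the strip.
\<close>

lemma primitive_imaginary_limit:
  assumes P: "\<And>w. w \<in> strip \<Longrightarrow> (P has_field_derivative binom_integrand c s w) (at w)"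
    and s: "0 < s"
  shows "((\<lambda>\<theta>. Im (P (Complex 0 \<theta>))) \<longlongrightarrow> Im (P 0) + 2 powr (s + 1) * cos_integral s (s * (1 - 2 * c))) (at_left pi)"
proof -
  let ?f = "\<lambda>x. cos x powr s * cos (s * (1 - 2 * c) * x)"
  let ?Q = "\<lambda>x. Im (P (Complex 0 (2 * x)))"
  have deriv: "(?Q has_vector_derivative 2 powr (s + 1) * ?f x) (at x)" if x: "0 \<le> x" "x < pi / 2" for x
  proof -
    have w: "Complex 0 (2 * x) \<in> strip" using x by (simp add: strip_def)
    have "((\<lambda>x. Complex 0 (2 * x)) has_vector_derivative Complex 0 2) (at x)"
      by (auto intro!: derivative_eq_intros has_vector_derivative_complex_iff[THEN iffD2] simp: has_vector_derivative_complex_iff)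
    from field_vector_diff_chain_at[OF this P[OF w]]
    have "((\<lambda>x. P (Complex 0 (2 * x))) has_vector_derivative Complex 0 2 * binom_integrand c s (Complex 0 (2 * x))) (at x)"
      by (simp add: o_def)
    from bounded_linear.has_vector_derivative[OF bounded_linear_Im this]
    have "(?Q has_vector_derivative 2 * Re (binom_integrand c s (Complex 0 (2 * x)))) (at x)"
      by simp
    then show ?thesis
      using binom_integrand_imaginary[OF x, of c s] by (simp add: powr_add mult_ac)
  qed
  have Q: "?Q x = Im (P 0) + 2 powr (s + 1) * integral {0..x} ?f" if x: "0 \<le> x" "x < pi / 2" for x
  proof -
    have "((\<lambda>x. 2 powr (s + 1) * ?f x) has_integral ?Q x - ?Q 0) {0..x}"
    proof (rule fundamental_theorem_of_calculus)
      fix y assume "y \<in> {0..x}"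
      then show "(?Q has_vector_derivative 2 powr (s + 1) * ?f y) (at y within {0..x})"
        using x by (auto intro: has_vector_derivative_at_within[OF deriv])
    qed (use x in simp)
    from integral_unique[OF this] have "?Q x - ?Q 0 = 2 powr (s + 1) * integral {0..x} ?f"
      by simp
    moreover have "Complex 0 (2 * 0) = 0" by (simp add: complex_eq_iff)
    ultimately show ?thesis by simp
  qed
  have "continuous_on {0..pi/2} (\<lambda>x. integral {0..x} ?f)"
    using s by (intro indefinite_integral_continuous_1 cos_powr_integrable continuous_intros)
  then have "((\<lambda>x. integral {0..x} ?f) \<longlongrightarrow> integral {0..pi/2} ?f) (at (pi/2) within {0..pi/2})"
    by (simp add: continuous_on_def)
  then have "((\<lambda>x. integral {0..x} ?f) \<longlongrightarrow> cos_integral s (s * (1 - 2 * c))) (at_left (pi/2))"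
    unfolding cos_integral_def
    by (simp add: at_within_Icc_at_left)
  then have "((\<lambda>x. Im (P 0) + 2 powr (s + 1) * integral {0..x} ?f) \<longlongrightarrow>
      Im (P 0) + 2 powr (s + 1) * cos_integral s (s * (1 - 2 * c))) (at_left (pi/2))"
    by (intro tendsto_intros)
  moreover have "\<forall>\<^sub>F x in at_left (pi/2). Im (P 0) + 2 powr (s + 1) * integral {0..x} ?f = ?Q x"
    using eventually_at_left_real[of 0 "pi/2", OF pi_half_gt_zero]
    by eventually_elim (simp add: Q)
  ultimately have lim: "(?Q \<longlongrightarrow> Im (P 0) + 2 powr (s + 1) * cos_integral s (s * (1 - 2 * c))) (at_left (pi/2))"
    by (rule Lim_transform_eventually)
  have "filterlim (\<lambda>\<theta>. \<theta> / 2) (at_left (pi/2)) (at_left pi)"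
    by (rule filterlim_at_withinI)
      (auto intro!: tendsto_eq_intros simp: eventually_at_filter)
  from filterlim_compose[OF lim this] show ?thesis
    by simp
qed

text \<open>
  The curve and the unit circle meet at \<open>z = -1\<close>. Just before that point they are joined by the short
  horizontal segment between \<open>kanter_curve c \<theta> + i\<theta>\<close> and \<open>i\<theta>\<close>, over which the bounded integrand
  contributes next to nothing.
\<close>

lemma primitive_kanter_curve_limit:
  assumes P: "\<And>w. w \<in> strip \<Longrightarrow> (P has_field_derivative binom_integrand c s w) (at w)"
    and s: "0 < s" and c: "0 < c" "c < 1"
  shows "((\<lambda>\<theta>. Im (P (Complex (kanter_curve c \<theta>) \<theta>))) \<longlongrightarrow>
           Im (P 0) + 2 powr (s + 1) * cos_integral s (s * (1 - 2 * c))) (at_left pi)"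
proof -
  define B where "B = exp (s * (ln (1 + exp 1) + c))"
  have diff: "norm (P (Complex x \<theta>) - P (Complex 0 \<theta>)) \<le> B * \<bar>x\<bar>"
    if "\<bar>x\<bar> \<le> 1" "\<bar>\<theta>\<bar> < pi" for x \<theta>
  proof -
    let ?S = "{w. \<bar>Re w\<bar> \<le> 1} \<inter> strip"
    have "{w. \<bar>Re w\<bar> \<le> 1} = {w. Re w \<le> 1} \<inter> {w. Re w \<ge> - 1}" by auto
    then have "convex {w. \<bar>Re w\<bar> \<le> 1}"
      by (metis convex_Int convex_halfspace_Re_le convex_halfspace_Re_ge)
    then have "convex ?S" by (intro convex_Int convex_strip)
    then have "norm (P (Complex x \<theta>) - P (Complex 0 \<theta>)) \<le> B * norm (Complex x \<theta> - Complex 0 \<theta>)"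
    proof (rule field_differentiable_bound)
      show "(P has_field_derivative binom_integrand c s w) (at w within ?S)" if "w \<in> ?S" for w
        using that by (auto intro: has_field_derivative_at_within[OF P])
      show "norm (binom_integrand c s w) \<le> B" if "w \<in> ?S" for w
        unfolding B_def using that s c by (intro norm_binom_integrand_le) auto
    qed (use that in \<open>auto simp: strip_def\<close>)
    also have "Complex x \<theta> - Complex 0 \<theta> = of_real x" by (simp add: complex_eq_iff)
    finally show ?thesis by simp
  qed
  have x0: "(kanter_curve c \<longlongrightarrow> 0) (at_left pi)"
    using c by (rule kanter_curve_at_pi)
  have "((\<lambda>\<theta>. Im (P (Complex (kanter_curve c \<theta>) \<theta>)) - Im (P (Complex 0 \<theta>))) \<longlongrightarrow> 0) (at_left pi)"
  proof (rule Lim_null_comparison)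
    have "\<forall>\<^sub>F \<theta> in at_left pi. \<bar>kanter_curve c \<theta>\<bar> < 1"
      using tendstoD[OF x0, of 1] by simp
    then show "\<forall>\<^sub>F \<theta> in at_left pi. norm (Im (P (Complex (kanter_curve c \<theta>) \<theta>)) - Im (P (Complex 0 \<theta>)))
        \<le> B * \<bar>kanter_curve c \<theta>\<bar>"
      using eventually_at_left_real[of 0 pi, OF pi_gt_zero]
    proof eventually_elim
      case (elim \<theta>)
      have "\<bar>Im (P (Complex (kanter_curve c \<theta>) \<theta>) - P (Complex 0 \<theta>))\<bar> \<le> B * \<bar>kanter_curve c \<theta>\<bar>"
        using diff[of "kanter_curve c \<theta>" \<theta>] elim by (intro order.trans[OF abs_Im_le_cmod]) auto
      then show ?case by simp
    qed
    show "((\<lambda>\<theta>. B * \<bar>kanter_curve c \<theta>\<bar>) \<longlongrightarrow> 0) (at_left pi)"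
      using tendsto_mult[OF tendsto_const[of B] tendsto_rabs[OF x0]] by simp
  qed
  from tendsto_add[OF this primitive_imaginary_limit[OF P s]] show ?thesis
    by simp
qed

lemma kanter_curve_has_derivative:
  assumes "0 < c" "c < 1" "0 < \<theta>" "\<theta> < pi"
  obtains D where "(kanter_curve c has_real_derivative D) (at \<theta>)"
proof -
  have "(kanter_curve c has_real_derivative
      (inverse (sin (c * \<theta>) / sin ((1 - c) * \<theta>))) *
        ((cos (c * \<theta>) * c * sin ((1 - c) * \<theta>) - sin (c * \<theta>) * (cos ((1 - c) * \<theta>) * (1 - c)))
          / (sin ((1 - c) * \<theta>) * sin ((1 - c) * \<theta>)))) (at \<theta>)"
    unfolding kanter_curve_def[abs_def] using kanter_sin_pos[OF assms]
    by (auto intro!: derivative_eq_intros)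
  then show ?thesis by (rule that)
qed

text \<open>
  The integrand is real on the curve, so only \<open>d\<theta>\<close>, the imaginary part of \<open>dw\<close>, survives when the imaginary
  part is taken.
\<close>

lemma primitive_kanter_curve_derivative:
  assumes P: "\<And>w. w \<in> strip \<Longrightarrow> (P has_field_derivative binom_integrand c s w) (at w)"
    and c: "0 < c" "c < 1" and \<theta>: "0 < \<theta>" "\<theta> < pi"
  shows "((\<lambda>\<theta>. Im (P (Complex (kanter_curve c \<theta>) \<theta>))) has_real_derivative kanter_b c (\<theta> / pi) powr s) (at \<theta>)"
proof -
  obtain D where "(kanter_curve c has_real_derivative D) (at \<theta>)"
    using kanter_curve_has_derivative[OF c \<theta>] .
  then have "((\<lambda>\<theta>. Complex (kanter_curve c \<theta>) \<theta>) has_vector_derivative Complex D 1) (at \<theta>)"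
    by (auto simp: has_vector_derivative_complex_iff)
  moreover have "Complex (kanter_curve c \<theta>) \<theta> \<in> strip"
    using \<theta> by (simp add: strip_def)
  ultimately have "(P \<circ> (\<lambda>\<theta>. Complex (kanter_curve c \<theta>) \<theta>) has_vector_derivative
      Complex D 1 * binom_integrand c s (Complex (kanter_curve c \<theta>) \<theta>)) (at \<theta>)"
    by (intro field_vector_diff_chain_at P)
  from bounded_linear.has_vector_derivative[OF bounded_linear_Im this]
  show ?thesis
    by (simp add: o_def binom_integrand_kanter_curve[OF c \<theta>] has_real_derivative_iff_has_vector_derivative)
qed

text \<open>
  The curve leaves the real axis at \<open>log(c/(1-c))\<close>, the imaginary segment at \<open>0\<close>. The piece of the real axis
  between the two adds only a real amount.
\<close>

lemma primitive_Im_real_const: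
  assumes P: "\<And>w. w \<in> strip \<Longrightarrow> (P has_field_derivative binom_integrand c s w) (at w)"
  shows "Im (P (of_real x)) = Im (P 0)"
proof -
  have "((\<lambda>x. Im (P (of_real x))) has_real_derivative 0) (at x)" for x
  proof -
    have "(P has_field_derivative binom_integrand c s (of_real x)) (at (of_real x))"
      by (intro P) (simp add: strip_def)
    moreover have "(of_real has_vector_derivative 1) (at x)"
      by (auto intro!: derivative_eq_intros)
    ultimately have "(P \<circ> of_real has_vector_derivative 1 * binom_integrand c s (of_real x)) (at x)"
      by (intro field_vector_diff_chain_at)
    from bounded_linear.has_vector_derivative[OF bounded_linear_Im this]
    show ?thesis
      using binom_integrand_real[of c s x]
      by (simp add: o_def has_real_derivative_iff_has_vector_derivative complex_is_Real_iff)
  qed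
  then have "Im (P (of_real x)) = Im (P (of_real 0))"
    by (rule DERIV_isconst_all[rule_format])
  then show ?thesis by simp
qed

lemma kanter_b_pos:
  assumes "0 < c" "c < 1" "0 < u" "u < 1"
  shows "0 < kanter_b c u"
  using kanter_sin_pos[of c "pi * u"] assms by (simp add: kanter_b_def mult_ac)

lemma isCont_kanter_b_powr:
  assumes "0 < c" "c < 1" "0 < u" "u < 1"
  shows "isCont (\<lambda>u. kanter_b c u powr s) u"
proof -
  have "isCont (kanter_b c) u"
    unfolding kanter_b_def[abs_def]
    using kanter_sin_pos[of c "pi * u"] assms
    by (intro continuous_intros) (auto simp: mult_ac)
  then show ?thesis
    using kanter_b_pos[OF assms] by (intro continuous_intros) auto
qed

text \<open>
  By conjugation symmetry the upper half of the contour suffices. Both paths, from a point of the real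
  axis to \<open>\<pi>i\<close>, change the imaginary part of the primitive by the same amount.
\<close>

theorem kanter_moment:
  assumes s: "0 < s" and c: "0 < c" "c < 1"
  shows "(LINT u:{0<..<1}|lborel. kanter_b c u powr s) = Gamma (1 + s) / (Gamma (1 + c * s) * Gamma (1 + (1 - c) * s))"
proof -
  obtain P where P: "\<And>w. w \<in> strip \<Longrightarrow> (P has_field_derivative binom_integrand c s w) (at w)"
    using binom_integrand_primitive[of c s] by blast
  define Q where "Q u = Im (P (Complex (kanter_curve c (pi * u)) (pi * u))) / pi" for u
  let ?t = "s * (1 - 2 * c)"
  have deriv: "(Q has_real_derivative kanter_b c u powr s) (at u)" if "0 < u" "u < 1" for u
  proof -
    have "((\<lambda>\<theta>. Im (P (Complex (kanter_curve c \<theta>) \<theta>))) has_real_derivative kanter_b c (pi * u / pi) powr s) (at (pi * u))"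
      using that by (intro primitive_kanter_curve_derivative P c) auto
    moreover have "((\<lambda>u. pi * u) has_real_derivative pi) (at u)"
      by (auto intro!: derivative_eq_intros)
    ultimately have "((\<lambda>u. Im (P (Complex (kanter_curve c (pi * u)) (pi * u)))) has_real_derivative kanter_b c (pi * u / pi) powr s * pi) (at u)"
      by (rule DERIV_chain2)
    from DERIV_cdivide[OF this, of pi] show ?thesis
      by (simp add: Q_def[abs_def])
  qed
  have lim0: "(Q \<longlongrightarrow> Im (P 0) / pi) (at_right 0)"
  proof -
    have "((\<lambda>\<theta>. Complex (kanter_curve c \<theta>) \<theta>) \<longlongrightarrow> Complex (ln (c / (1 - c))) 0) (at_right 0)"
      by (intro tendsto_Complex kanter_curve_at_0 c) (auto intro!: tendsto_eq_intros)
    moreover have "Complex (ln (c / (1 - c))) 0 = of_real (ln (c / (1 - c)))"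
      by (simp add: complex_eq_iff)
    moreover have "isCont P (of_real (ln (c / (1 - c))))"
      by (intro DERIV_isCont[OF P]) (simp add: strip_def)
    ultimately have "((\<lambda>\<theta>. P (Complex (kanter_curve c \<theta>) \<theta>)) \<longlongrightarrow> P (of_real (ln (c / (1 - c))))) (at_right 0)"
      by (metis isCont_tendsto_compose)
    then have "((\<lambda>\<theta>. Im (P (Complex (kanter_curve c \<theta>) \<theta>)) / pi) \<longlongrightarrow>
        Im (P (of_real (ln (c / (1 - c))))) / pi) (at_right 0)"
      by (intro tendsto_divide tendsto_Im tendsto_const) auto
    then have "((\<lambda>\<theta>. Im (P (Complex (kanter_curve c \<theta>) \<theta>)) / pi) \<longlongrightarrow> Im (P 0) / pi) (at_right 0)"
      by (simp only: primitive_Im_real_const[OF P])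
    moreover have "filterlim (\<lambda>u. pi * u) (at_right 0) (at_right 0)"
      by real_asymp
    ultimately show ?thesis
      unfolding Q_def[abs_def] by (rule filterlim_compose)
  qed
  have lim1: "(Q \<longlongrightarrow> (Im (P 0) + 2 powr (s + 1) * cos_integral s ?t) / pi) (at_left 1)"
  proof -
    have "((\<lambda>\<theta>. Im (P (Complex (kanter_curve c \<theta>) \<theta>)) / pi) \<longlongrightarrow>
        (Im (P 0) + 2 powr (s + 1) * cos_integral s ?t) / pi) (at_left pi)"
      by (intro tendsto_divide tendsto_const primitive_kanter_curve_limit[OF P s c]) auto
    moreover have "filterlim (\<lambda>u. pi * u) (at_left pi) (at_left 1)"
      by (rule filterlim_at_withinI) (auto intro!: tendsto_eq_intros simp: eventually_at_filter)
    ultimately show ?thesis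
      unfolding Q_def[abs_def] by (rule filterlim_compose)
  qed
  have FTC: "(LBINT u=0..1. kanter_b c u powr s) = (Im (P 0) + 2 powr (s + 1) * cos_integral s ?t) / pi - Im (P 0) / pi"
    unfolding zero_ereal_def one_ereal_def
    using lim0 lim1
    by (intro interval_integral_FTC_nonneg(2)[where F = Q] deriv isCont_kanter_b_powr c;
        simp add: ereal_tendsto_simps)
  have ein: "einterval 0 1 = {0<..<1::real}"
    by (auto simp: einterval_def zero_ereal_def one_ereal_def)
  have "\<bar>?t\<bar> < s"
    using s c by (auto simp: abs_mult intro!: mult_less_cancel_left1[THEN iffD2])
  then have "cos_integral s ?t = pi / (2 * gamma_factor s ?t)"
    by (rule cos_integral_eq)
  moreover have "(s + ?t) / 2 = (1 - c) * s" "(s - ?t) / 2 = c * s"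
    by (simp_all add: algebra_simps diff_divide_distrib add_divide_distrib)
  ultimately have "2 powr (s + 1) * cos_integral s ?t
      = pi * (Gamma (1 + s) / (Gamma (1 + c * s) * Gamma (1 + (1 - c) * s)))"
    by (simp add: gamma_factor_def powr_add)
  then show "(LINT u:{0<..<1}|lborel. kanter_b c u powr s) = Gamma (1 + s) / (Gamma (1 + c * s) * Gamma (1 + (1 - c) * s))"
    using FTC by (simp add: interval_lebesgue_integral_def ein add_divide_distrib)
qed

section \<open>The Laplace transform of the logarithm of the Kanter variable\<close>

text \<open>
  The numerator \<open>z cos z - sin z\<close> of the derivative vanishes at \<open>0\<close> and has derivative \<open>- z sin z < 0\<close>.
\<close>

lemma sinc_strict_antimono:
  fixes x y :: real
  assumes "0 < x" "x < y" "y < pi"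
  shows "sin y / y < sin x / x"
proof (rule DERIV_neg_imp_decreasing[OF assms(2)])
  fix z :: real assume z: "x \<le> z" "z \<le> y"
  have "z * cos z - sin z < 0 * cos 0 - sin 0"
  proof (rule DERIV_neg_imp_decreasing_open[where f = "\<lambda>z. z * cos z - sin z"])
    show "0 < z" using z assms by simp
    show "\<exists>d. ((\<lambda>z. z * cos z - sin z) has_real_derivative d) (at w) \<and> d < 0" if "0 < w" "w < z" for w
    proof (intro exI conjI)
      show "((\<lambda>z. z * cos z - sin z) has_real_derivative - (w * sin w)) (at w)"
        by (auto intro!: derivative_eq_intros)
      show "- (w * sin w) < 0"
        using that z assms by (auto intro!: mult_pos_pos sin_gt_zero)
    qed
  qed (intro continuous_intros)
  then have "(cos z * z - sin z) / (z * z) < 0"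
    using z assms by (intro divide_neg_pos) (auto simp: mult.commute)
  moreover have "((\<lambda>z. sin z / z) has_real_derivative (cos z * z - sin z) / (z * z)) (at z)"
    using z assms by (auto intro!: derivative_eq_intros)
  ultimately show "\<exists>d. ((\<lambda>z. sin z / z) has_real_derivative d) (at z) \<and> d < 0"
    by blast
qed

lemma kanter_kappa_pos: "0 < c \<Longrightarrow> c < 1 \<Longrightarrow> 0 < kanter_kappa c"
  by (simp add: kanter_kappa_def)

lemma ln_kanter_kappa:
  assumes "0 < c" "c < 1"
  shows "ln (kanter_kappa c) = - (c * ln c + (1 - c) * ln (1 - c))"
  using assms by (simp add: kanter_kappa_def ln_mult ln_powr algebra_simps)

text \<open>
  The ratio of \<open>b\<^sub>c\<close> to \<open>\<kappa>\<^sub>c\<close> is the quotient of \<open>sinc \<theta>\<close> by the weighted geometric mean of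
  \<open>sinc(c\<theta>)\<close> and \<open>sinc((1-c)\<theta>)\<close>, where \<open>sinc x = sin x / x\<close> is strictly decreasing and
  \<open>\<theta> = \<pi>u\<close>.
\<close>

lemma kanter_b_less_kappa:
  assumes c: "0 < c" "c < 1" and u: "0 < u" "u < 1"
  shows "kanter_b c u < kanter_kappa c"
proof -
  define \<theta> where "\<theta> = pi * u"
  have \<theta>: "0 < \<theta>" "\<theta> < pi" using u by (auto simp: \<theta>_def)
  note pos = kanter_sin_pos[OF c \<theta>]
  have sinc: "ln (sin \<theta> / \<theta>) < ln (sin (k * \<theta>) / (k * \<theta>))" if "0 < k" "k < 1" for k
    using that \<theta> sinc_strict_antimono[of "k * \<theta>" \<theta>] kanter_sin_pos[OF that \<theta>]
    by (subst ln_less_cancel_iff) auto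
  have "ln (sin \<theta>) - ln \<theta> = c * (ln (sin \<theta>) - ln \<theta>) + (1 - c) * (ln (sin \<theta>) - ln \<theta>)"
    by (simp add: left_diff_distrib)
  also have "\<dots> < c * (ln (sin (c * \<theta>)) - (ln c + ln \<theta>)) + (1 - c) * (ln (sin ((1 - c) * \<theta>)) - (ln (1 - c) + ln \<theta>))"
    using sinc[of c] sinc[of "1 - c"] c \<theta> pos
    by (intro add_strict_mono mult_strict_left_mono) (auto simp: ln_div ln_mult)
  finally have "ln (sin \<theta>) - c * ln (sin (c * \<theta>)) - (1 - c) * ln (sin ((1 - c) * \<theta>)) < ln (kanter_kappa c)"
    unfolding ln_kanter_kappa[OF c] by (simp add: algebra_simps)
  also have "ln (sin \<theta>) - c * ln (sin (c * \<theta>)) - (1 - c) * ln (sin ((1 - c) * \<theta>)) = ln (kanter_b c u)"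
    using pos by (simp add: kanter_b_def \<theta>_def ln_div ln_mult ln_powr mult_ac)
  finally show ?thesis
    using kanter_b_pos[OF c u] kanter_kappa_pos[OF c] by simp
qed

lemma kanter_b_measurable [measurable]: "kanter_b c \<in> borel_measurable borel"
  unfolding kanter_b_def[abs_def] by measurable

lemma kanter_W_measurable [measurable]:
  assumes [measurable]: "U \<in> borel_measurable M"
  shows "kanter_W c U \<in> borel_measurable M"
  unfolding kanter_W_def[abs_def] kanter_K_def[abs_def] by measurable

lemma AE_uniform_range:
  assumes "U \<in> borel_measurable M" "distr M borel U = uniform_measure lborel {0<..<1::real}"
  shows "AE \<omega> in M. 0 < U \<omega> \<and> U \<omega> < 1"
proof -
  have "AE u in uniform_measure lborel {0<..<1::real}. u \<in> {0<..<1}"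
    by (intro AE_uniform_measureI) auto
  then have "AE u in distr M borel U. u \<in> {0<..<1}"
    unfolding assms(2) .
  then show ?thesis
    using assms(1) by (simp add: AE_distr_iff)
qed

lemma integral_uniform_unit:
  fixes g :: "real \<Rightarrow> real"
  assumes "g \<in> borel_measurable borel"
  shows "integral\<^sup>L (uniform_measure lborel {0<..<1}) g = (LINT u:{0<..<1}|lborel. g u)"
proof -
  have "uniform_measure lborel {0<..<1::real} = density lborel (\<lambda>u. ennreal (indicator {0<..<1} u))"
    unfolding uniform_measure_def by (intro arg_cong2[where f = density] ext refl) (simp add: ennreal_indicator divide_ennreal_def)
  then show ?thesis
    using assms by (simp add: integral_density set_lebesgue_integral_def)
qed

lemma kanter_W_laplace:
  fixes s :: real
  assumes U: "U \<in> borel_measurable M" "distr M borel U = uniform_measure lborel {0<..<1::real}"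
    and c: "0 < c" "c < 1" and s: "0 < s"
  shows "(LINT \<omega>|M. exp (- s * kanter_W c U \<omega>))
           = Gamma (1 + s) / (Gamma (1 + c * s) * Gamma (1 + (1 - c) * s)) / kanter_kappa c powr s"
proof -
  let ?g = "\<lambda>u. exp (- s * - ln (inverse (kanter_kappa c) * kanter_b c u))"
  have "(LINT \<omega>|M. exp (- s * kanter_W c U \<omega>)) = integral\<^sup>L (distr M borel U) ?g"
    using U by (subst integral_distr) (auto simp: kanter_W_def kanter_K_def)
  also have "\<dots> = (LINT u:{0<..<1}|lborel. ?g u)"
    unfolding U(2) by (rule integral_uniform_unit) measurable
  also have "\<dots> = (LINT u:{0<..<1}|lborel. kanter_b c u powr s / kanter_kappa c powr s)"
  proof (rule set_lebesgue_integral_cong)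
    show "\<forall>u. u \<in> {0<..<1} \<longrightarrow> ?g u = kanter_b c u powr s / kanter_kappa c powr s"
    proof (intro allI impI)
      fix u :: real assume u: "u \<in> {0<..<1}"
      have "?g u = (kanter_b c u / kanter_kappa c) powr s"
        using kanter_b_pos[OF c, of u] kanter_kappa_pos[OF c] u
        by (simp add: powr_def divide_inverse mult.commute)
      then show "?g u = kanter_b c u powr s / kanter_kappa c powr s"
        using kanter_b_pos[OF c, of u] kanter_kappa_pos[OF c] u
        by (simp add: powr_divide)
    qed
  qed simp
  also have "\<dots> = (LINT u:{0<..<1}|lborel. kanter_b c u powr s) / kanter_kappa c powr s"
    by (rule set_integral_divide_zero)
  finally show ?thesis
    by (simp only: kanter_moment[OF s c])
qed

text \<open>
  Positivity of \<open>W\<^sub>c\<close> is the strict bound \<open>b\<^sub>c < \<kappa>\<^sub>c\<close>. The value \<open>s = 0\<close> of the Laplace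
  transform is treated apart, as the moment formula is stated for \<open>s > 0\<close>.
\<close>

lemma kanter_W_self_decomposable_with:
  assumes "prob_space M"
    and U: "U \<in> borel_measurable M" "distr M borel U = uniform_measure lborel {0<..<1::real}"
    and c: "0 < c" "c < 1"
  shows "self_decomposable_with M (kanter_W c U) 0 (kanter_spectral c)"
proof -
  interpret prob_space M by fact
  have pos: "AE \<omega> in M. 0 < kanter_W c U \<omega>"
    using AE_uniform_range[OF U]
  proof eventually_elim
    case (elim \<omega>)
    have "0 < inverse (kanter_kappa c) * kanter_b c (U \<omega>)"
      using kanter_b_pos[OF c, of "U \<omega>"] kanter_kappa_pos[OF c] elim by simp
    moreover have "inverse (kanter_kappa c) * kanter_b c (U \<omega>) < 1"
      using kanter_b_less_kappa[OF c, of "U \<omega>"] kanter_kappa_pos[OF c] elim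
      by (simp add: field_simps)
    ultimately show ?case
      by (simp add: kanter_W_def kanter_K_def ln_less_zero)
  qed
  have main: "set_integrable lborel {0<..} (\<lambda>x. (1 - exp (- s * x)) * (kanter_spectral c x / x)) \<and>
        (LINT \<omega>|M. exp (- s * kanter_W c U \<omega>)) =
          exp (- (0 * s + (LINT x:{0<..}|lborel. (1 - exp (- s * x)) * (kanter_spectral c x / x))))"
    if s: "0 \<le> s" for s
  proof
    let ?f = "\<lambda>x. (1 - exp (- s * x)) * (kanter_spectral c x / x)"
    let ?I = "ln (Gamma (1 + c * s)) + ln (Gamma (1 + (1 - c) * s)) - ln (Gamma (1 + s))
             - s * (c * ln c + (1 - c) * ln (1 - c))"
    have "has_bochner_integral lborel (\<lambda>x. indicator {0<..} x *\<^sub>R ?f x) ?I"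
      using kanter_spectral_integral[OF s c] by (simp add: has_bochner_integral_restrict_space)
    then have int: "set_integrable lborel {0<..} ?f" and val: "(LINT x:{0<..}|lborel. ?f x) = ?I"
      by (auto simp: has_bochner_integral_iff set_integrable_def set_lebesgue_integral_def)
    show "set_integrable lborel {0<..} ?f" by (rule int)
    show "(LINT \<omega>|M. exp (- s * kanter_W c U \<omega>)) = exp (- (0 * s + (LINT x:{0<..}|lborel. ?f x)))"
    proof (cases "s = 0")
      case True
      then show ?thesis by (simp add: prob_space set_lebesgue_integral_def)
    next
      case False
      with s have "0 < s" by simp
      have G: "0 < Gamma (1 + s)" "0 < Gamma (1 + c * s)" "0 < Gamma (1 + (1 - c) * s)"
        using s c by (auto intro!: Gamma_real_pos add_pos_nonneg)
      have "- (0 * s + ?I) = ln (Gamma (1 + s)) - (ln (Gamma (1 + c * s)) + ln (Gamma (1 + (1 - c) * s)))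
          - s * ln (kanter_kappa c)"
        by (simp add: ln_kanter_kappa[OF c] algebra_simps)
      also have "exp \<dots> = Gamma (1 + s) / (Gamma (1 + c * s) * Gamma (1 + (1 - c) * s)) / kanter_kappa c powr s"
        using G kanter_kappa_pos[OF c] by (simp add: exp_diff exp_add powr_def)
      finally show ?thesis
        unfolding val by (simp only: kanter_W_laplace[OF U c \<open>0 < s\<close>])
    qed
  qed
  show ?thesis
    unfolding self_decomposable_with_def
    using main pos kanter_spectral_nonneg[OF c] kanter_spectral_antimono[OF c] kanter_W_measurable[OF U(1)]
    by (simp add: prob_space_axioms)
qed

theorem lemma1:
  fixes M :: "'a measure" and U :: "'a \<Rightarrow> real" and \<beta> :: real
  assumes "prob_space M"
    and "U \<in> borel_measurable M"
    and "distr M borel U = uniform_measure lborel {0<..<1}"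
    and "0 < \<beta>" and "\<beta> < 1"
  shows "self_decomposable M (kanter_W \<beta> U) \<and>
    (\<exists>\<phi>. self_decomposable_with M (kanter_W \<beta> U) 0 \<phi> \<and> (\<phi> \<longlongrightarrow> 1 / 2) (at_right 0))"
  using kanter_W_self_decomposable_with[OF assms] kanter_spectral_at_0[OF assms(4,5)]
  unfolding self_decomposable_def by blast

end
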